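(* Let $(M_1^{n_1},F_1)$ and $(M_2^{n_2},F_2)$ be Finsler manifolds of finite Holmes-Thompson volume, and let $f$ be a positive smooth function on $M_1$ such that $a\le f\le b$ for some constants $0<a\le b<\infty$. Then the Finsler warped product $M=M_1\times_f M_2$, with base $M_1$ and fiber $M_2$, also has finite Holmes-Thompson volume.
   Context: A Finsler metric on a smooth manifold $M$ is a continuous $F:TM\to[0,\infty)$, smooth on $TM^0=TM\setminus\{0\}$, positively 1-homogeneous on fibers, with $g_{ij}=\frac12\frac{\partial^2F^2}{\partial y^i\partial y^j}$ positive definite on $TM^0$. The Holmes-Thompson volume form of an $n$-dimensional $(M,F)$ is $dV_{HT}=\sigma_{HT}(x)\,dx$ with $\sigma_{HT}(x)=\frac{1}{\operatorname{Vol}(\mathbb B^n(1))}\int_{F(x,y)<1}\det(g_{ij}(x,y))\,dy$, where $\mathbb B^n(1)$ is the Euclidean unit ball. The Finsler warped product $M=M_1\times_f M_2$ of a base $(M_1,F_1)$ and fiber $(M_2,F_2)$ with warping function $f>0$ smooth on $M_1$ is $M_1\times M_2$ with $F^2(x_1,y_1,x_2,y_2)=F_1^2(x_1,y_1)+f^2(x_1)F_2^2(x_2,y_2)$ on $TM_1^0\times TM_2^0$; its fundamental tensor is block diagonal with blocks $g_{ij}(x_1,y_1)$ and $f^2(x_1)g_{\alpha\beta}(x_2,y_2)$, where $g_{ij},g_{\alpha\beta}$ are the fundamental tensors of $F_1,F_2$. *)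

theory Defs
  imports "HOL-Analysis.Analysis" "HOL-Combinatorics.Permutations"
begin

section \<open>Smooth manifolds\<close>

text \<open>
  Used on open sets only, where it is the class of \<open>k\<close> times continuously differentiable maps: in
  finite dimension, a map all of whose directional derivatives are continuous is continuously
  differentiable.
\<close>

primrec Ck_on :: "nat \<Rightarrow> 'a::euclidean_space set \<Rightarrow> ('a \<Rightarrow> 'b::real_normed_vector) \<Rightarrow> bool" where
  "Ck_on 0 S f \<longleftrightarrow> continuous_on S f"
| "Ck_on (Suc k) S f \<longleftrightarrow>
     (\<forall>x\<in>S. f differentiable (at x)) \<and> (\<forall>v. Ck_on k S (\<lambda>x. frechet_derivative f (at x) v))"

definition smooth_on :: "'a::euclidean_space set \<Rightarrow> ('a \<Rightarrow> 'b::real_normed_vector) \<Rightarrow> bool" where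
  "smooth_on S f \<longleftrightarrow> (\<forall>k. Ck_on k S f)"

text \<open>
  A manifold is a Hausdorff, second countable type \<open>'m\<close> with a smooth atlas modelled on a Euclidean
  space \<open>'e\<close>; its dimension is \<open>DIM('e)\<close>. A chart is a pair \<open>(U, \<phi>)\<close>; the values of \<open>\<phi>\<close> outside \<open>U\<close>
  are irrelevant. Atlases need not be maximal.
\<close>

type_synonym ('m, 'e) chart = "'m set \<times> ('m \<Rightarrow> 'e)"

definition chart_image :: "('m, 'e) chart \<Rightarrow> 'e set" where
  "chart_image c = snd c ` fst c"

definition chart_inv :: "('m, 'e) chart \<Rightarrow> 'e \<Rightarrow> 'm" where
  "chart_inv c = inv_into (fst c) (snd c)"

definition is_chart :: "('m::topological_space, 'e::euclidean_space) chart \<Rightarrow> bool" where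
  "is_chart c \<longleftrightarrow> open (fst c) \<and> open (chart_image c) \<and>
     homeomorphism (fst c) (chart_image c) (snd c) (chart_inv c)"

definition smooth_atlas ::
    "('m::{second_countable_topology,t2_space}, 'e::euclidean_space) chart set \<Rightarrow> bool" where
  "smooth_atlas A \<longleftrightarrow> (\<forall>c\<in>A. is_chart c) \<and> (\<Union>c\<in>A. fst c) = UNIV \<and>
     (\<forall>c\<in>A. \<forall>d\<in>A. smooth_on (snd c ` (fst c \<inter> fst d)) (snd d \<circ> chart_inv c))"

definition smooth_functions :: "('m, 'e::euclidean_space) chart set \<Rightarrow> ('m \<Rightarrow> real) set" where
  "smooth_functions A = {h. \<forall>c\<in>A. smooth_on (chart_image c) (h \<circ> chart_inv c)}"

definition product_chart ::
    "('m, 'e) chart \<Rightarrow> ('n, 'f) chart \<Rightarrow> ('m \<times> 'n, 'e \<times> 'f) chart" where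
  "product_chart c d = (fst c \<times> fst d, map_prod (snd c) (snd d))"

definition product_atlas ::
    "('m, 'e) chart set \<Rightarrow> ('n, 'f) chart set \<Rightarrow> ('m \<times> 'n, 'e \<times> 'f) chart set" where
  "product_atlas A1 A2 = {product_chart c d | c d. c \<in> A1 \<and> d \<in> A2}"


section \<open>Tangent vectors\<close>

text \<open>
  Tangent vectors at \<open>p\<close> are the derivations at \<open>p\<close> of the algebra of smooth functions; they are
  extended by 0 to non-smooth functions, so that a tangent vector is determined by its values on
  smooth functions.
\<close>

definition tangent_space ::
    "('m, 'e::euclidean_space) chart set \<Rightarrow> 'm \<Rightarrow> (('m \<Rightarrow> real) \<Rightarrow> real) set" where
  "tangent_space A p = {D.
     (\<forall>h\<in>smooth_functions A. \<forall>k\<in>smooth_functions A. D (\<lambda>q. h q + k q) = D h + D k) \<and>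
     (\<forall>r. \<forall>h\<in>smooth_functions A. D (\<lambda>q. r * h q) = r * D h) \<and>
     (\<forall>h\<in>smooth_functions A. \<forall>k\<in>smooth_functions A.
        D (\<lambda>q. h q * k q) = h p * D k + D h * k p) \<and>
     (\<forall>h. h \<notin> smooth_functions A \<longrightarrow> D h = 0)}"

text \<open>The vector \<open>\<Sum>i. y\<^sup>i \<partial>/\<partial>x\<^sup>i\<close> at the point with coordinates \<open>x\<close> in the chart \<open>c\<close>.\<close>

definition coord_vector ::
    "('m, 'e::euclidean_space) chart set \<Rightarrow> ('m, 'e) chart \<Rightarrow> 'e \<Rightarrow> 'e \<Rightarrow> ('m \<Rightarrow> real) \<Rightarrow> real" where
  "coord_vector A c x y = (\<lambda>h. if h \<in> smooth_functions A
     then frechet_derivative (h \<circ> chart_inv c) (at x) y else 0)"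

text \<open>The differential of \<open>\<phi>\<close>, as a map into the tangent vectors of the manifold with atlas \<open>A\<close>.\<close>

definition pushforward ::
    "('m, 'e::euclidean_space) chart set \<Rightarrow> ('n \<Rightarrow> 'm) \<Rightarrow> (('n \<Rightarrow> real) \<Rightarrow> real) \<Rightarrow>
     ('m \<Rightarrow> real) \<Rightarrow> real" where
  "pushforward A \<phi> v = (\<lambda>h. if h \<in> smooth_functions A then v (h \<circ> \<phi>) else 0)"


section \<open>Finsler metrics\<close>

text \<open>A function on the tangent bundle; only its values on tangent vectors matter.\<close>

type_synonym 'm tangent_function = "'m \<Rightarrow> (('m \<Rightarrow> real) \<Rightarrow> real) \<Rightarrow> real"

definition local_expr ::
    "('m, 'e::euclidean_space) chart set \<Rightarrow> 'm tangent_function \<Rightarrow> ('m, 'e) chart \<Rightarrow>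
     'e \<Rightarrow> 'e \<Rightarrow> real" where
  "local_expr A F c x y = F (chart_inv c x) (coord_vector A c x y)"

definition dir_deriv :: "('e::euclidean_space \<Rightarrow> real) \<Rightarrow> 'e \<Rightarrow> 'e \<Rightarrow> real" where
  "dir_deriv h i y = deriv (\<lambda>t. h (y + t *\<^sub>R i)) 0"

text \<open>The components are indexed by basis vectors \<open>i, j \<in> Basis\<close>.\<close>

definition fundamental_tensor ::
    "('m, 'e::euclidean_space) chart set \<Rightarrow> 'm tangent_function \<Rightarrow> ('m, 'e) chart \<Rightarrow>
     'e \<Rightarrow> 'e \<Rightarrow> 'e \<Rightarrow> 'e \<Rightarrow> real" where
  "fundamental_tensor A F c x y i j =
     1 / 2 * dir_deriv (dir_deriv (\<lambda>z. (local_expr A F c x z)\<^sup>2) j) i y"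

definition finsler_metric ::
    "('m, 'e::euclidean_space) chart set \<Rightarrow> 'm tangent_function \<Rightarrow> bool" where
  "finsler_metric A F \<longleftrightarrow>
     (\<forall>p. \<forall>v\<in>tangent_space A p. 0 \<le> F p v) \<and>
     (\<forall>c\<in>A. continuous_on (chart_image c \<times> UNIV) (\<lambda>(x, y). local_expr A F c x y)) \<and>
     (\<forall>c\<in>A. smooth_on (chart_image c \<times> (UNIV - {0})) (\<lambda>(x, y). local_expr A F c x y)) \<and>
     (\<forall>p. \<forall>v\<in>tangent_space A p. \<forall>r>0. F p (\<lambda>h. r * v h) = r * F p v) \<and>
     (\<forall>c\<in>A. \<forall>x\<in>chart_image c. \<forall>y. y \<noteq> 0 \<longrightarrow>
        (\<forall>w. w \<noteq> 0 \<longrightarrow>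
          0 < (\<Sum>i\<in>Basis. \<Sum>j\<in>Basis.
                fundamental_tensor A F c x y i j * (w \<bullet> i) * (w \<bullet> j))))"

definition finsler_manifold ::
    "('m::{second_countable_topology,t2_space}, 'e::euclidean_space) chart set \<Rightarrow>
     'm tangent_function \<Rightarrow> bool" where
  "finsler_manifold A F \<longleftrightarrow> smooth_atlas A \<and> finsler_metric A F"

text \<open>
  The defining equation \<open>F\<^sup>2 = F\<^sub>1\<^sup>2 + f\<^sup>2 F\<^sub>2\<^sup>2\<close> is imposed for vectors with both components nonzero; here
  it is used on the whole tangent bundle, as the continuous extension. In general the result is not
  smooth at nonzero vectors having one zero component, so it need not be a Finsler metric in the
  sense above.
\<close>

definition warped_metric ::
    "('m, 'e::euclidean_space) chart set \<Rightarrow> ('n, 'f::euclidean_space) chart set \<Rightarrow>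
     ('m \<Rightarrow> real) \<Rightarrow> 'm tangent_function \<Rightarrow> 'n tangent_function \<Rightarrow> ('m \<times> 'n) tangent_function" where
  "warped_metric A1 A2 f F1 F2 = (\<lambda>p v.
     sqrt ((F1 (fst p) (pushforward A1 fst v))\<^sup>2 +
           (f (fst p))\<^sup>2 * (F2 (snd p) (pushforward A2 snd v))\<^sup>2))"


section \<open>Holmes-Thompson volume\<close>

text \<open>
  Leibniz formula for the determinant of a matrix indexed by \<open>Basis\<close>; the library determinant is
  restricted to matrices indexed by a finite type, with which it agrees.
\<close>

definition basis_det :: "('e::euclidean_space \<Rightarrow> 'e \<Rightarrow> real) \<Rightarrow> real" where
  "basis_det B = (\<Sum>p | p permutes Basis. of_int (sign p) * (\<Prod>i\<in>Basis. B i (p i)))"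

lemma basis_det_eq_det:
  fixes B :: "real ^ 'n \<Rightarrow> real ^ 'n \<Rightarrow> real"
  shows "basis_det B = det (\<chi> i j. B (axis i 1) (axis j 1))"
proof -
  let ?a = "\<lambda>i::'n. axis i (1::real)"
  let ?b = "inv_into UNIV ?a"
  have inj: "inj ?a"
    by (auto simp: inj_on_def axis_eq_axis)
  have Basis: "(Basis :: (real ^ 'n) set) = range ?a"
    by (auto simp: Basis_vec_def)
  have bij: "bij_betw ?a UNIV (Basis :: (real ^ 'n) set)"
    using inj Basis by (simp add: bij_betw_def)
  have bij': "bij_betw ?b (Basis :: (real ^ 'n) set) UNIV"
    using bij by (rule bij_betw_inv_into)
  have "det (\<chi> i j. B (?a i) (?a j)) =
      (\<Sum>p | p permutes (UNIV :: 'n set). of_int (sign p) * (\<Prod>i\<in>UNIV. B (?a i) (?a (p i))))"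
    by (simp add: det_def)
  also have "\<dots> = basis_det B"
    unfolding basis_det_def
  proof (rule sum.reindex_bij_witness
      [where j = "map_permutation UNIV ?a" and i = "map_permutation Basis ?b"])
    fix p :: "'n \<Rightarrow> 'n" assume "p \<in> {p. p permutes UNIV}"
    then have p: "p permutes UNIV" by simp
    show "map_permutation Basis ?b (map_permutation UNIV ?a p) = p"
      using bij p by (rule map_permutation_compose_inv) (rule inv_into_f_f [OF inj], simp)
    show "map_permutation UNIV ?a p \<in> {q. q permutes Basis}"
      using map_permutation_permutes [OF bij p] by simp
    have "(\<Prod>i\<in>Basis. B i (map_permutation UNIV ?a p i)) =
        (\<Prod>i\<in>UNIV. B (?a i) (map_permutation UNIV ?a p (?a i)))"
      by (rule prod.reindex_bij_betw [OF bij, symmetric])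
    then show "of_int (sign (map_permutation UNIV ?a p)) *
        (\<Prod>i\<in>Basis. B i (map_permutation UNIV ?a p i)) =
        of_int (sign p) * (\<Prod>i\<in>UNIV. B (?a i) (?a (p i)))"
      by (simp add: map_permutation_apply [OF inj] sign_map_permutation [OF inj p])
  next
    fix q :: "real ^ 'n \<Rightarrow> real ^ 'n" assume "q \<in> {q. q permutes Basis}"
    then have q: "q permutes Basis" by simp
    show "map_permutation UNIV ?a (map_permutation Basis ?b q) = q"
      using bij' q by (rule map_permutation_compose_inv) (rule f_inv_into_f, simp add: Basis)
    show "map_permutation Basis ?b q \<in> {p. p permutes UNIV}"
      using map_permutation_permutes [OF bij' q] by simp
  qed
  finally show ?thesis ..
qed

text \<open>
  The density \<open>\<sigma>\<close> in the chart \<open>c\<close>. For a warped product the fundamental tensor is only meaningful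
  when both components of \<open>y\<close> are nonzero; the other vectors form a null set and do not contribute.
\<close>

definition HT_density ::
    "('m, 'e::euclidean_space) chart set \<Rightarrow> 'm tangent_function \<Rightarrow> ('m, 'e) chart \<Rightarrow>
     'e \<Rightarrow> ennreal" where
  "HT_density A F c x =
     (\<integral>\<^sup>+y\<in>{y. local_expr A F c x y < 1}. ennreal (basis_det (fundamental_tensor A F c x y)) \<partial>lborel) /
     emeasure lborel (ball (0::'e) 1)"

text \<open>The measure \<open>\<sigma>(x) dx\<close> of one chart, as a measure on the manifold supported on the chart domain.\<close>

definition HT_chart_measure ::
    "('m::topological_space, 'e::euclidean_space) chart set \<Rightarrow> 'm tangent_function \<Rightarrow>
     ('m, 'e) chart \<Rightarrow> 'm measure" where
  "HT_chart_measure A F c =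
     distr (density (restrict_space lborel (chart_image c)) (HT_density A F c)) borel (chart_inv c)"

text \<open>
  The chart measures agree on overlaps, since \<open>\<sigma>(x) dx\<close> does not depend on the coordinates. The
  measure obtained by gluing them is their supremum, see \<open>HT_measure_eqI\<close>.
\<close>

definition HT_measure ::
    "('m::topological_space, 'e::euclidean_space) chart set \<Rightarrow> 'm tangent_function \<Rightarrow> 'm measure" where
  "HT_measure A F = (SUP c\<in>A. HT_chart_measure A F c)"

definition HT_volume ::
    "('m::topological_space, 'e::euclidean_space) chart set \<Rightarrow> 'm tangent_function \<Rightarrow> ennreal" where
  "HT_volume A F = emeasure (HT_measure A F) UNIV"

lemma sets_HT_chart_measure [simp]: "sets (HT_chart_measure A F c) = sets borel"
  by (simp add: HT_chart_measure_def)

lemma emeasure_HT_chart_measure_Int: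
  assumes c: "is_chart c" and B: "B \<in> sets borel"
  shows "emeasure (HT_chart_measure A F c) (B \<inter> fst c) = emeasure (HT_chart_measure A F c) B"
proof -
  let ?N = "density (restrict_space lborel (chart_image c)) (HT_density A F c)"
  have "continuous_on (chart_image c) (chart_inv c)"
    using c by (simp add: is_chart_def homeomorphism_def)
  then have "chart_inv c \<in> borel_measurable (restrict_space borel (chart_image c))"
    by (rule borel_measurable_continuous_on_restrict)
  then have m: "chart_inv c \<in> measurable ?N borel"
    by (simp add: measurable_def space_restrict_space sets_restrict_space)
  have U: "fst c \<in> sets borel"
    using c by (simp add: is_chart_def)
  have "chart_inv c x \<in> fst c" if "x \<in> space ?N" for x
    using that c by (auto simp: space_restrict_space is_chart_def homeomorphism_def)
  then have "chart_inv c -` (B \<inter> fst c) \<inter> space ?N = chart_inv c -` B \<inter> space ?N"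
    by blast
  then show ?thesis
    using m U B by (simp add: HT_chart_measure_def emeasure_distr)
qed

lemma HT_measure_eqI:
  fixes A :: "('m::{second_countable_topology,t2_space}, 'e::euclidean_space) chart set"
  assumes A: "smooth_atlas A" and sets: "sets \<mu> = sets borel"
    and eq: "\<And>c B. c \<in> A \<Longrightarrow> B \<in> sets borel \<Longrightarrow> B \<subseteq> fst c \<Longrightarrow>
               emeasure \<mu> B = emeasure (HT_chart_measure A F c) B"
  shows "HT_measure A F = \<mu>"
proof (rule antisym)
  have chart: "is_chart c" if "c \<in> A" for c
    using A that by (simp add: smooth_atlas_def)
  then have U: "open (fst c)" if "c \<in> A" for c
    using that by (simp add: is_chart_def)
  show "HT_measure A F \<le> \<mu>"
    unfolding HT_measure_def
  proof (rule SUP_least)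
    fix c assume c: "c \<in> A"
    show "HT_chart_measure A F c \<le> \<mu>"
    proof (subst le_measure)
      show "\<forall>B\<in>sets (HT_chart_measure A F c). emeasure (HT_chart_measure A F c) B \<le> emeasure \<mu> B"
      proof
        fix B assume "B \<in> sets (HT_chart_measure A F c)"
        then have B: "B \<in> sets borel" by simp
        have "emeasure (HT_chart_measure A F c) B = emeasure (HT_chart_measure A F c) (B \<inter> fst c)"
          using emeasure_HT_chart_measure_Int [OF chart [OF c] B] by simp
        also have "\<dots> = emeasure \<mu> (B \<inter> fst c)"
          using eq [OF c, of "B \<inter> fst c"] B U [OF c] by simp
        also have "\<dots> \<le> emeasure \<mu> B"
          using B by (intro emeasure_mono) (auto simp: sets)
        finally show "emeasure (HT_chart_measure A F c) B \<le> emeasure \<mu> B" .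
      qed
    qed (simp add: sets)
  qed
  have "A \<noteq> {}"
    using A by (auto simp: smooth_atlas_def)
  then have HT_sets: "sets (HT_measure A F) = sets borel"
    unfolding HT_measure_def by (intro sets_SUP) auto
  obtain \<U> where \<U>: "\<U> \<subseteq> fst ` A" "countable \<U>" "\<Union>\<U> = \<Union>(fst ` A)"
    by (rule Lindelof [of "fst ` A"]) (use U in auto)
  have "\<Union>\<U> = UNIV"
    using \<U>(3) A by (simp add: smooth_atlas_def)
  then have "\<U> \<noteq> {}" by auto
  define V where "V = from_nat_into \<U>"
  have V: "\<exists>c\<in>A. V n = fst c" for n
    using \<U>(1) from_nat_into [OF \<open>\<U> \<noteq> {}\<close>, of n] by (auto simp: V_def)
  have UV: "(\<Union>n. V n) = UNIV"
    using range_from_nat_into [OF \<open>\<U> \<noteq> {}\<close> \<U>(2)] \<open>\<Union>\<U> = UNIV\<close> by (simp add: V_def)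
  have Vb: "V n \<in> sets borel" for n
    using V [of n] U by auto
  show "\<mu> \<le> HT_measure A F"
  proof (subst le_measure)
    show "\<forall>B\<in>sets \<mu>. emeasure \<mu> B \<le> emeasure (HT_measure A F) B"
    proof
      fix B assume "B \<in> sets \<mu>"
      then have B: "B \<in> sets borel" by (simp add: sets)
      define D where "D n = B \<inter> disjointed V n" for n
      have Db: "D n \<in> sets borel" for n
        using B Vb by (auto simp: D_def disjointed_def intro!: sets.Int sets.Diff sets.finite_UN)
      then have rD: "range D \<subseteq> sets borel" by blast
      have dis: "disjoint_family D"
        using disjoint_family_disjointed [of V] by (auto simp: D_def disjoint_family_on_def)
      have UD: "(\<Union>n. D n) = B"
        using UN_disjointed_eq [of V] UV by (auto simp: D_def)
      have le: "emeasure \<mu> (D n) \<le> emeasure (HT_measure A F) (D n)" for n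
      proof -
        obtain c where c: "c \<in> A" "V n = fst c" using V by blast
        have "D n \<subseteq> fst c"
          using disjointed_subset [of V n] c by (auto simp: D_def)
        then have "emeasure \<mu> (D n) = emeasure (HT_chart_measure A F c) (D n)"
          using eq c Db by blast
        also have "\<dots> \<le> emeasure (HT_measure A F) (D n)"
          using c(1) by (intro le_measureD3) (auto simp: HT_sets, auto simp: HT_measure_def intro: SUP_upper)
        finally show ?thesis .
      qed
      have "emeasure \<mu> B = (\<Sum>n. emeasure \<mu> (D n))"
        using suminf_emeasure [of D \<mu>] rD dis by (simp add: sets UD)
      also have "\<dots> \<le> (\<Sum>n. emeasure (HT_measure A F) (D n))"
        by (intro suminf_le le) auto
      also have "\<dots> = emeasure (HT_measure A F) B"
        using suminf_emeasure [of D "HT_measure A F"] rD dis by (simp add: HT_sets UD)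
      finally show "emeasure \<mu> B \<le> emeasure (HT_measure A F) B" .
    qed
  qed (simp add: sets HT_sets)
qed

end

theory Submission
  imports Defs "Jordan_Normal_Form.Determinant"
begin

text \<open>
  In a product chart the fundamental tensor of the warped product is block diagonal with blocks
  \<open>g\<^sub>1(x\<^sub>1, y\<^sub>1)\<close> and \<open>f\<^sup>2 g\<^sub>2(x\<^sub>2, y\<^sub>2)\<close>, away from the null set of vectors with a zero component. Its
  indicatrix body lies in \<open>{F\<^sub>1 < 1} \<times> {f F\<^sub>2 < 1}\<close>, and \<open>det g\<^sub>2\<close> is homogeneous of degree 0 in \<open>y\<^sub>2\<close>.
  Substituting \<open>f y\<^sub>2\<close> for \<open>y\<^sub>2\<close>, the density is therefore at most \<open>K \<sigma>\<^sub>1(x\<^sub>1) \<sigma>\<^sub>2(x\<^sub>2)\<close>, where \<open>K\<close> is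
  \<open>b\<close> to the power \<open>n\<^sub>2\<close> times a quotient of volumes of unit balls. Each product chart measure is then
  at most \<open>K\<close> times the product of the Holmes-Thompson measures of the factors. So is their supremum,
  and it is not needed that the chart measures agree on overlaps.
\<close>

section \<open>Smooth functions and tangent vectors\<close>

lemma Ck_on_cong:
  assumes "open S" "\<And>x. x \<in> S \<Longrightarrow> f x = g x" "Ck_on k S f"
  shows "Ck_on k S g"
  using assms(2,3)
proof (induction k arbitrary: f g)
  case 0
  then show ?case by (simp cong: continuous_on_cong)
next
  case (Suc k)
  have der: "(g has_derivative frechet_derivative f (at x)) (at x)" if "x \<in> S" for x
  \<comment> \<open>Since \<open>S\<close> is open, \<open>f\<close> and \<open>g\<close> agree near
    \<open>x\<close>, so a derivative of \<open>f\<close> at \<open>x\<close> is also one of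
    \<open>g\<close>.\<close>
  proof (rule has_derivative_transform_within_open [OF _ assms(1) that])
    show "(f has_derivative frechet_derivative f (at x)) (at x)"
      using Suc.prems(2) that by (simp add: frechet_derivative_works)
  qed (use Suc.prems(1) in auto)
  have "Ck_on k S (\<lambda>x. frechet_derivative g (at x) v)" for v
  proof (rule Suc.IH)
    show "frechet_derivative f (at x) v = frechet_derivative g (at x) v" if "x \<in> S" for x
      using frechet_derivative_at [OF der [OF that]] by simp
  qed (use Suc.prems(2) in simp)
  then show ?case
    using der by (auto simp: differentiable_def)
qed

text \<open>Introduction rule with an explicit derivative in place of the choice-based
  \<open>frechet_derivative\<close>; the sum, product and chain rules are fed into it below.\<close>

lemma Ck_on_Suc:
  assumes "open S" and der: "\<And>x. x \<in> S \<Longrightarrow> (f has_derivative f' x) (at x)"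
    and Ck: "\<And>v. Ck_on k S (\<lambda>x. f' x v)"
  shows "Ck_on (Suc k) S f"
proof -
  have "Ck_on k S (\<lambda>x. frechet_derivative f (at x) v)" for v
    using Ck by (rule Ck_on_cong [OF assms(1), rotated]) (simp add: frechet_derivative_at [OF der, symmetric])
  then show ?thesis
    using der by (auto simp: differentiable_def)
qed

lemma Ck_on_has_derivative:
  "Ck_on (Suc k) S f \<Longrightarrow> x \<in> S \<Longrightarrow> (f has_derivative frechet_derivative f (at x)) (at x)"
  by (simp add: frechet_derivative_works)

lemma Ck_on_SucD: "Ck_on (Suc k) S f \<Longrightarrow> Ck_on k S f"
proof (induction k arbitrary: f)
  case 0
  then show ?case
    by (auto intro!: continuous_at_imp_continuous_on differentiable_imp_continuous_within)
qed auto

lemma Ck_on_const: "Ck_on k S (\<lambda>x. c)"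
  by (induction k arbitrary: c) (auto simp: continuous_on_const)

lemma Ck_on_add:
  assumes "open S"
  shows "Ck_on k S f \<Longrightarrow> Ck_on k S g \<Longrightarrow> Ck_on k S (\<lambda>x. f x + g x)"
proof (induction k arbitrary: f g)
  case (Suc k)
  show ?case
  proof (rule Ck_on_Suc [OF assms])
    fix x assume "x \<in> S"
    then show "((\<lambda>x. f x + g x) has_derivative
        (\<lambda>v. frechet_derivative f (at x) v + frechet_derivative g (at x) v)) (at x)"
      using Suc.prems by (intro has_derivative_add Ck_on_has_derivative)
  qed (use Suc in auto)
qed (auto intro: continuous_on_add)

lemma Ck_on_mult:
  fixes f g :: "'a::euclidean_space \<Rightarrow> real"
  assumes "open S"
  shows "Ck_on k S f \<Longrightarrow> Ck_on k S g \<Longrightarrow> Ck_on k S (\<lambda>x. f x * g x)"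
proof (induction k arbitrary: f g)
  case (Suc k)
  show ?case
  proof (rule Ck_on_Suc [OF assms])
    fix x assume "x \<in> S"
    then show "((\<lambda>x. f x * g x) has_derivative
        (\<lambda>v. f x * frechet_derivative g (at x) v + frechet_derivative f (at x) v * g x)) (at x)"
      using Suc.prems by (intro has_derivative_mult Ck_on_has_derivative)
  next
    fix v
    show "Ck_on k S (\<lambda>x. f x * frechet_derivative g (at x) v + frechet_derivative f (at x) v * g x)"
      \<comment> \<open>The undifferentiated factors have one order of differentiability to spare,
        so both products fall under the induction hypothesis.\<close>
      using Suc.prems Ck_on_SucD [OF Suc.prems(1)] Ck_on_SucD [OF Suc.prems(2)]
      by (intro Ck_on_add [OF assms] Suc.IH) auto
  qed
qed (auto intro: continuous_on_mult)

text \<open>By the chain rule, the derivative of \<open>h \<circ> g\<close> in the direction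
  \<open>v\<close> is the derivative of \<open>h\<close> in the fixed direction \<open>g v\<close>,
  composed with \<open>g\<close>. This has the same shape, which closes the induction. The maps
  \<open>g\<close> of interest are the projections of a product.\<close>

lemma Ck_on_compose_linear:
  assumes "open S" "open T" "bounded_linear g" "g ` T \<subseteq> S"
  shows "Ck_on k S h \<Longrightarrow> Ck_on k T (h \<circ> g)"
proof (induction k arbitrary: h)
  case 0
  then show ?case
    using continuous_on_compose [OF linear_continuous_on [OF assms(3), of T], of h] assms(4)
    by (auto intro: continuous_on_subset)
next
  case (Suc k)
  show ?case
  proof (rule Ck_on_Suc [OF assms(2)])
    fix x assume x: "x \<in> T"
    have "(g has_derivative g) (at x)"
      using assms(3) by (rule bounded_linear_imp_has_derivative)
    moreover have "(h has_derivative frechet_derivative h (at (g x))) (at (g x))"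
      using Suc.prems x assms(4) by (intro Ck_on_has_derivative) auto
    ultimately show "(h \<circ> g has_derivative (\<lambda>v. frechet_derivative h (at (g x)) (g v))) (at x)"
      using diff_chain_at by (fastforce simp: o_def)
  next
    fix v
    show "Ck_on k T (\<lambda>x. frechet_derivative h (at (g x)) (g v))"
      using Suc.IH [of "\<lambda>x. frechet_derivative h (at x) (g v)"] Suc.prems by (simp add: o_def)
  qed
qed

lemma smooth_on_mult:
  fixes f g :: "'a::euclidean_space \<Rightarrow> real"
  shows "open S \<Longrightarrow> smooth_on S f \<Longrightarrow> smooth_on S g \<Longrightarrow> smooth_on S (\<lambda>x. f x * g x)"
  by (simp add: smooth_on_def Ck_on_mult)

lemma smooth_on_add:
  "open S \<Longrightarrow> smooth_on S f \<Longrightarrow> smooth_on S g \<Longrightarrow> smooth_on S (\<lambda>x. f x + g x)"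
  by (simp add: smooth_on_def Ck_on_add)

lemma smooth_on_const: "smooth_on S (\<lambda>x. c)"
  by (simp add: smooth_on_def Ck_on_const)

lemma smooth_on_compose_linear:
  assumes "open S" "open T" "bounded_linear g" "g ` T \<subseteq> S" "smooth_on S h"
  shows "smooth_on T (h \<circ> g)"
  using assms(5) unfolding smooth_on_def by (auto intro: Ck_on_compose_linear [OF assms(1-4)])

lemma smooth_on_cong:
  "open S \<Longrightarrow> (\<And>x. x \<in> S \<Longrightarrow> f x = g x) \<Longrightarrow> smooth_on S f \<Longrightarrow> smooth_on S g"
  unfolding smooth_on_def using Ck_on_cong by blast

lemma smooth_on_has_derivative:
  "smooth_on S f \<Longrightarrow> x \<in> S \<Longrightarrow> (f has_derivative frechet_derivative f (at x)) (at x)"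
  using Ck_on_has_derivative unfolding smooth_on_def by blast

lemma smooth_on_frechet_derivative:
  assumes "smooth_on S f" shows "smooth_on S (\<lambda>x. frechet_derivative f (at x) v)"
  unfolding smooth_on_def
proof
  fix k
  have "Ck_on (Suc k) S f" using assms unfolding smooth_on_def ..
  then show "Ck_on k S (\<lambda>x. frechet_derivative f (at x) v)" by simp
qed

lemma smooth_on_imp_continuous_on: "smooth_on S f \<Longrightarrow> continuous_on S f"
  unfolding smooth_on_def using Ck_on.simps(1) by blast

lemma smooth_atlas_is_chart: "smooth_atlas A \<Longrightarrow> c \<in> A \<Longrightarrow> is_chart c"
  by (simp add: smooth_atlas_def)

lemma open_chart_image: "smooth_atlas A \<Longrightarrow> c \<in> A \<Longrightarrow> open (chart_image c)"
  by (auto simp: smooth_atlas_def is_chart_def)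

section \<open>Smooth functions and coordinate vectors of one atlas\<close>

context
  fixes A :: "('m::{second_countable_topology,t2_space}, 'e::euclidean_space) chart set"
  assumes A: "smooth_atlas A"
begin

lemma smooth_functions_add:
  "h \<in> smooth_functions A \<Longrightarrow> k \<in> smooth_functions A \<Longrightarrow> (\<lambda>q. h q + k q) \<in> smooth_functions A"
  unfolding smooth_functions_def o_def
  by (intro CollectI ballI smooth_on_add open_chart_image [OF A]) auto

lemma smooth_functions_mult:
  "h \<in> smooth_functions A \<Longrightarrow> k \<in> smooth_functions A \<Longrightarrow> (\<lambda>q. h q * k q) \<in> smooth_functions A"
  unfolding smooth_functions_def o_def
  by (intro CollectI ballI smooth_on_mult open_chart_image [OF A]) auto

lemma smooth_functions_const: "(\<lambda>q. r) \<in> smooth_functions A"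
  by (auto simp: smooth_functions_def o_def smooth_on_const)

lemma smooth_functions_has_derivative:
  assumes "h \<in> smooth_functions A" "c \<in> A" "x \<in> chart_image c"
  shows "((\<lambda>z. h (chart_inv c z)) has_derivative
    frechet_derivative (h \<circ> chart_inv c) (at x)) (at x)"
  using smooth_on_has_derivative [of "chart_image c" "h \<circ> chart_inv c" x] assms
  by (auto simp: smooth_functions_def o_def)

text \<open>The sum and product rules make it a derivation. Membership matters because
  \<open>finsler_metric\<close> imposes homogeneity on tangent vectors only.\<close>

lemma coord_vector_mem_tangent_space:
  assumes c: "c \<in> A" and x: "x \<in> chart_image c"
  shows "coord_vector A c x y \<in> tangent_space A (chart_inv c x)"
proof -
  let ?d = "\<lambda>h. frechet_derivative (h \<circ> chart_inv c) (at x)"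
  have 1: "?d (\<lambda>q. h q + k q) y = ?d h y + ?d k y"
    if "h \<in> smooth_functions A" "k \<in> smooth_functions A" for h k
    using frechet_derivative_at [OF has_derivative_add [OF smooth_functions_has_derivative
        [OF that(1) c x] smooth_functions_has_derivative [OF that(2) c x]], symmetric]
    by (simp add: o_def)
  have 2: "?d (\<lambda>q. h q * k q) y = h (chart_inv c x) * ?d k y + ?d h y * k (chart_inv c x)"
    if "h \<in> smooth_functions A" "k \<in> smooth_functions A" for h k
    using frechet_derivative_at [OF has_derivative_mult [OF smooth_functions_has_derivative
        [OF that(1) c x] smooth_functions_has_derivative [OF that(2) c x]], symmetric]
    by (simp add: o_def)
  have 3: "?d (\<lambda>q. r * h q) y = r * ?d h y" if "h \<in> smooth_functions A" for h r
    using frechet_derivative_at [OF has_derivative_mult_right [OF smooth_functions_has_derivative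
        [OF that c x], of r], symmetric]
    by (simp add: o_def)
  show ?thesis
    unfolding tangent_space_def coord_vector_def
    using 1 2 3 smooth_functions_add smooth_functions_mult smooth_functions_const
    by auto
qed

lemma coord_vector_scaleR:
  assumes c: "c \<in> A" and x: "x \<in> chart_image c"
  shows "coord_vector A c x (r *\<^sub>R y) = (\<lambda>h. r * coord_vector A c x y h)"
proof
  fix h
  have "linear (frechet_derivative (h \<circ> chart_inv c) (at x))" if "h \<in> smooth_functions A"
    using smooth_functions_has_derivative [OF that c x] has_derivative_linear by blast
  then show "coord_vector A c x (r *\<^sub>R y) h = r * coord_vector A c x y h"
    by (simp add: coord_vector_def linear_cmul)
qed

end

lemma local_expr_scaleR:
  assumes "finsler_manifold A F" "c \<in> A" "x \<in> chart_image c" "0 < r"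
  shows "local_expr A F c x (r *\<^sub>R y) = r * local_expr A F c x y"
  using assms coord_vector_mem_tangent_space [of A c x y]
  by (simp add: local_expr_def coord_vector_scaleR finsler_manifold_def finsler_metric_def)

section \<open>Product charts and the warped metric in product coordinates\<close>

lemma chart_inv_chart: "is_chart c \<Longrightarrow> p \<in> fst c \<Longrightarrow> chart_inv c (snd c p) = p"
  by (simp add: is_chart_def homeomorphism_def)

lemma inj_on_chart: "is_chart c \<Longrightarrow> inj_on (snd c) (fst c)"
  by (metis chart_inv_chart inj_onI)

lemma chart_image_product_chart:
  "chart_image (product_chart c d) = chart_image c \<times> chart_image d"
  by (auto simp: chart_image_def product_chart_def map_prod_surj_on)

text \<open>\<open>inv_into\<close> merely chooses a preimage; injectivity of the product of the two
  chart maps forces the choice.\<close>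

lemma chart_inv_product_chart:
  assumes c: "is_chart c" and d: "is_chart d" and x: "x \<in> chart_image c" "z \<in> chart_image d"
  shows "chart_inv (product_chart c d) (x, z) = (chart_inv c x, chart_inv d z)"
proof -
  have "inj_on (map_prod (snd c) (snd d)) (fst c \<times> fst d)"
    using inj_on_chart [OF c] inj_on_chart [OF d] by (rule map_prod_inj_on)
  moreover obtain p q where pq: "p \<in> fst c" "x = snd c p" "q \<in> fst d" "z = snd d q"
    using x by (auto simp: chart_image_def)
  ultimately have "inv_into (fst c \<times> fst d) (map_prod (snd c) (snd d)) (x, z) = (p, q)"
    using inv_into_f_f [of "map_prod (snd c) (snd d)" "fst c \<times> fst d" "(p, q)"] by simp
  then show ?thesis
    using pq chart_inv_chart [OF c] chart_inv_chart [OF d]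
    by (simp add: chart_inv_def product_chart_def)
qed

context
  fixes A1 :: "('m1::{second_countable_topology,t2_space}, 'e1::euclidean_space) chart set"
    and A2 :: "('m2::{second_countable_topology,t2_space}, 'e2::euclidean_space) chart set"
  assumes A1: "smooth_atlas A1" and A2: "smooth_atlas A2"
begin

text \<open>In product coordinates \<open>h \<circ> fst\<close> is the coordinate form of
  \<open>h\<close> after a linear projection. The result keeps \<open>coord_vector\<close> from
  falling back on its default value 0 when a vector is pushed forward.\<close>

lemma smooth_functions_fst:
  assumes h: "h \<in> smooth_functions A1"
  shows "h \<circ> fst \<in> smooth_functions (product_atlas A1 A2)"
proof -
  have *: "smooth_on (chart_image c \<times> chart_image d) (h \<circ> fst \<circ> chart_inv (product_chart c d))"
    if c: "c \<in> A1" and d: "d \<in> A2" for c d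
  proof (rule smooth_on_cong)
    show op: "open (chart_image c \<times> chart_image d)"
      by (intro open_Times open_chart_image [OF A1 c] open_chart_image [OF A2 d])
    show "smooth_on (chart_image c \<times> chart_image d) ((h \<circ> chart_inv c) \<circ> fst)"
      by (rule smooth_on_compose_linear [OF open_chart_image [OF A1 c] op bounded_linear_fst])
        (use h c in \<open>auto simp: smooth_functions_def\<close>)
  next
    fix z assume "z \<in> chart_image c \<times> chart_image d"
    then have "chart_inv (product_chart c d) z = (chart_inv c (fst z), chart_inv d (snd z))"
      using chart_inv_product_chart [OF smooth_atlas_is_chart [OF A1 c] smooth_atlas_is_chart [OF A2 d]]
      by (cases z) simp
    then show "(h \<circ> chart_inv c \<circ> fst) z = (h \<circ> fst \<circ> chart_inv (product_chart c d)) z"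
      by simp
  qed
  have "smooth_on (chart_image e) (h \<circ> fst \<circ> chart_inv e)" if e: "e \<in> product_atlas A1 A2" for e
  proof -
    obtain c d where "e = product_chart c d" "c \<in> A1" "d \<in> A2"
      using e unfolding product_atlas_def by blast
    then show ?thesis
      using * by (simp only: chart_image_product_chart)
  qed
  then show ?thesis
    unfolding smooth_functions_def by blast
qed

lemma smooth_functions_snd:
  assumes h: "h \<in> smooth_functions A2"
  shows "h \<circ> snd \<in> smooth_functions (product_atlas A1 A2)"
proof -
  have *: "smooth_on (chart_image c \<times> chart_image d) (h \<circ> snd \<circ> chart_inv (product_chart c d))"
    if c: "c \<in> A1" and d: "d \<in> A2" for c d
  proof (rule smooth_on_cong)
    show op: "open (chart_image c \<times> chart_image d)"
      by (intro open_Times open_chart_image [OF A1 c] open_chart_image [OF A2 d])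
    show "smooth_on (chart_image c \<times> chart_image d) ((h \<circ> chart_inv d) \<circ> snd)"
      by (rule smooth_on_compose_linear [OF open_chart_image [OF A2 d] op bounded_linear_snd])
        (use h d in \<open>auto simp: smooth_functions_def\<close>)
  next
    fix z assume "z \<in> chart_image c \<times> chart_image d"
    then have "chart_inv (product_chart c d) z = (chart_inv c (fst z), chart_inv d (snd z))"
      using chart_inv_product_chart [OF smooth_atlas_is_chart [OF A1 c] smooth_atlas_is_chart [OF A2 d]]
      by (cases z) simp
    then show "(h \<circ> chart_inv d \<circ> snd) z = (h \<circ> snd \<circ> chart_inv (product_chart c d)) z"
      by simp
  qed
  have "smooth_on (chart_image e) (h \<circ> snd \<circ> chart_inv e)" if e: "e \<in> product_atlas A1 A2" for e
  proof -
    obtain c d where "e = product_chart c d" "c \<in> A1" "d \<in> A2"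
      using e unfolding product_atlas_def by blast
    then show ?thesis
      using * by (simp only: chart_image_product_chart)
  qed
  then show ?thesis
    unfolding smooth_functions_def by blast
qed

text \<open>The projections of the product manifold are linear in coordinates, so their
  differentials send the vector with coordinates \<open>y\<close> to those with coordinates
  \<open>fst y\<close> and \<open>snd y\<close>.\<close>

lemma local_expr_warped_metric:
  assumes c: "c \<in> A1" and d: "d \<in> A2" and x: "x1 \<in> chart_image c" "x2 \<in> chart_image d"
  shows "local_expr (product_atlas A1 A2) (warped_metric A1 A2 f F1 F2) (product_chart c d)
      (x1, x2) y =
    sqrt ((local_expr A1 F1 c x1 (fst y))\<^sup>2 +
      (f (chart_inv c x1))\<^sup>2 * (local_expr A2 F2 d x2 (snd y))\<^sup>2)"
proof -
  let ?P = "product_atlas A1 A2" and ?e = "product_chart c d"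
  have cd: "is_chart c" "is_chart d"
    using smooth_atlas_is_chart A1 A2 c d by blast+
  have op: "open (chart_image c \<times> chart_image d)"
    by (intro open_Times open_chart_image [OF A1 c] open_chart_image [OF A2 d])
  have mem: "(x1, x2) \<in> chart_image c \<times> chart_image d" using x by simp
  have "frechet_derivative (h \<circ> fst \<circ> chart_inv ?e) (at (x1, x2)) y =
      frechet_derivative (h \<circ> chart_inv c) (at x1) (fst y)" if h: "h \<in> smooth_functions A1" for h
  proof -
    have "((h \<circ> chart_inv c) \<circ> fst has_derivative
        frechet_derivative (h \<circ> chart_inv c) (at x1) \<circ> fst) (at (x1, x2))"
    proof (rule diff_chain_at)
      show "(fst has_derivative fst) (at (x1, x2))"
        by (rule bounded_linear_imp_has_derivative [OF bounded_linear_fst])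
    qed (use smooth_functions_has_derivative [OF A1 h c x(1)] in \<open>simp add: o_def\<close>)
    then have "(h \<circ> fst \<circ> chart_inv ?e has_derivative
        frechet_derivative (h \<circ> chart_inv c) (at x1) \<circ> fst) (at (x1, x2))"
      by (rule has_derivative_transform_within_open [OF _ op mem])
        (auto simp: chart_inv_product_chart [OF cd])
    then show ?thesis
      by (simp add: frechet_derivative_at [symmetric])
  qed
  then have 1: "pushforward A1 fst (coord_vector ?P ?e (x1, x2) y) = coord_vector A1 c x1 (fst y)"
    using smooth_functions_fst by (intro ext) (simp add: pushforward_def coord_vector_def)
  have "frechet_derivative (h \<circ> snd \<circ> chart_inv ?e) (at (x1, x2)) y =
      frechet_derivative (h \<circ> chart_inv d) (at x2) (snd y)" if h: "h \<in> smooth_functions A2" for h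
  proof -
    have "((h \<circ> chart_inv d) \<circ> snd has_derivative
        frechet_derivative (h \<circ> chart_inv d) (at x2) \<circ> snd) (at (x1, x2))"
    proof (rule diff_chain_at)
      show "(snd has_derivative snd) (at (x1, x2))"
        by (rule bounded_linear_imp_has_derivative [OF bounded_linear_snd])
    qed (use smooth_functions_has_derivative [OF A2 h d x(2)] in \<open>simp add: o_def\<close>)
    then have "(h \<circ> snd \<circ> chart_inv ?e has_derivative
        frechet_derivative (h \<circ> chart_inv d) (at x2) \<circ> snd) (at (x1, x2))"
      by (rule has_derivative_transform_within_open [OF _ op mem])
        (auto simp: chart_inv_product_chart [OF cd])
    then show ?thesis
      by (simp add: frechet_derivative_at [symmetric])
  qed
  then have 2: "pushforward A2 snd (coord_vector ?P ?e (x1, x2) y) = coord_vector A2 d x2 (snd y)"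
    using smooth_functions_snd by (intro ext) (simp add: pushforward_def coord_vector_def)
  show ?thesis
    by (simp add: local_expr_def warped_metric_def chart_inv_product_chart [OF cd x] 1 2)
qed

end

section \<open>Determinants over a basis\<close>

no_notation scalar_prod (infix \<open>\<bullet>\<close> 70)

text \<open>Numbering the basis leads to matrices whose size is a number, for which block
  decompositions and kernel vectors are at hand. Reindexing transports permutations along
  \<open>b\<close>, which preserves their signs.\<close>

lemma basis_det_eq_det_mat:
  assumes bij: "bij_betw b {0..<n} (Basis :: 'e::euclidean_space set)"
  shows "basis_det B = Determinant.det (Matrix.mat n n (\<lambda>(i, j). B (b i) (b j)))"
proof -
  let ?c = "inv_into {0..<n} b"
  have inj: "inj_on b {0..<n}" and img: "b ` {0..<n} = Basis"
    using bij by (auto simp: bij_betw_def)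
  have bij': "bij_betw ?c Basis {0..<n}"
    using bij by (rule bij_betw_inv_into)
  have "Determinant.det (Matrix.mat n n (\<lambda>(i, j). B (b i) (b j))) =
      (\<Sum>p | p permutes {0..<n}. of_int (sign p) * (\<Prod>i\<in>{0..<n}. B (b i) (b (p i))))"
    by (subst det_def' [of _ n])
      (auto intro!: sum.cong prod.cong arg_cong2 [where f = "(*)"] simp: permutes_in_image [of _ "{0..<n}", simplified])
  also have "\<dots> = basis_det B"
    unfolding basis_det_def
  proof (rule sum.reindex_bij_witness
      [where j = "map_permutation {0..<n} b" and i = "map_permutation Basis ?c"])
    fix p assume "p \<in> {p. p permutes {0..<n}}"
    then have p: "p permutes {0..<n}" by simp
    show "map_permutation Basis ?c (map_permutation {0..<n} b p) = p"
      using bij p by (rule map_permutation_compose_inv) (rule inv_into_f_f [OF inj])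
    show "map_permutation {0..<n} b p \<in> {q. q permutes Basis}"
      using map_permutation_permutes [OF bij p] by simp
    have "(\<Prod>i\<in>Basis. B i (map_permutation {0..<n} b p i)) =
        (\<Prod>i\<in>{0..<n}. B (b i) (map_permutation {0..<n} b p (b i)))"
      by (rule prod.reindex_bij_betw [OF bij, symmetric])
    then show "of_int (sign (map_permutation {0..<n} b p)) *
        (\<Prod>i\<in>Basis. B i (map_permutation {0..<n} b p i)) =
        of_int (sign p) * (\<Prod>i\<in>{0..<n}. B (b i) (b (p i)))"
      by (simp add: map_permutation_apply [OF inj] sign_map_permutation [OF inj p])
  next
    fix q :: "'e \<Rightarrow> 'e" assume "q \<in> {q. q permutes Basis}"
    then have q: "q permutes Basis" by simp
    show "map_permutation {0..<n} b (map_permutation Basis ?c q) = q"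
      using bij' q by (rule map_permutation_compose_inv) (simp add: f_inv_into_f img)
    show "map_permutation Basis ?c q \<in> {p. p permutes {0..<n}}"
      using map_permutation_permutes [OF bij' q] by simp
  qed
  finally show ?thesis ..
qed

lemma basis_det_scale:
  "basis_det (\<lambda>i j. c * B i j) = c ^ DIM('e::euclidean_space) * basis_det (B :: 'e \<Rightarrow> 'e \<Rightarrow> real)"
  by (simp add: basis_det_def prod.distrib sum_distrib_left mult_ac)

lemma basis_det_one: "basis_det (\<lambda>i j :: 'e::euclidean_space. of_bool (i = j)) = 1"
proof -
  obtain b :: "nat \<Rightarrow> 'e" where b: "bij_betw b {0..<DIM('e)} Basis"
    using ex_bij_betw_nat_finite finite_Basis by blast
  have "Matrix.mat DIM('e) DIM('e) (\<lambda>(i, j). of_bool (b i = b j)) = (1\<^sub>m DIM('e) :: real mat)"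
    using b by (intro eq_matI) (auto simp: bij_betw_def inj_on_eq_iff)
  then show ?thesis
    using basis_det_eq_det_mat [OF b] by simp
qed

lemma continuous_on_basis_det:
  assumes "\<And>i j. i \<in> Basis \<Longrightarrow> j \<in> Basis \<Longrightarrow> continuous_on S (\<lambda>x. B x i j)"
  shows "continuous_on S (\<lambda>x. basis_det (B x))"
  unfolding basis_det_def
  by (intro continuous_intros assms) (auto simp: permutes_in_image)

text \<open>The basis of the product is listed with the vectors of the first factor before those of
  the second; in this order the matrix is block diagonal.\<close>

lemma basis_det_block_diagonal:
  fixes B1 :: "'e1::euclidean_space \<Rightarrow> 'e1 \<Rightarrow> real" and B2 :: "'e2::euclidean_space \<Rightarrow> 'e2 \<Rightarrow> real"
  assumes 11: "\<And>i j. i \<in> Basis \<Longrightarrow> j \<in> Basis \<Longrightarrow> B (i, 0) (j, 0) = B1 i j"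
    and 22: "\<And>i j. i \<in> Basis \<Longrightarrow> j \<in> Basis \<Longrightarrow> B (0, i) (0, j) = B2 i j"
    and 12: "\<And>i j. i \<in> Basis \<Longrightarrow> j \<in> Basis \<Longrightarrow> B (i, 0) (0, j) = 0"
    and 21: "\<And>i j. i \<in> Basis \<Longrightarrow> j \<in> Basis \<Longrightarrow> B (0, i) (j, 0) = 0"
  shows "basis_det B = basis_det B1 * basis_det B2"
proof -
  let ?m = "DIM('e1)" and ?n = "DIM('e2)"
  obtain b1 :: "nat \<Rightarrow> 'e1" where b1: "bij_betw b1 {0..<?m} Basis"
    using ex_bij_betw_nat_finite finite_Basis by blast
  obtain b2 :: "nat \<Rightarrow> 'e2" where b2: "bij_betw b2 {0..<?n} Basis"
    using ex_bij_betw_nat_finite finite_Basis by blast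
  define b where "b k = (if k < ?m then (b1 k, 0) else (0, b2 (k - ?m)))" for k
  have b1B: "b1 k \<in> Basis" if "k < ?m" for k using b1 that by (auto simp: bij_betw_def)
  have b2B: "b2 k \<in> Basis" if "k < ?n" for k using b2 that by (auto simp: bij_betw_def)
  have "bij_betw b {0..<?m} ((\<lambda>u. (u, 0)) ` Basis)"
  proof -
    have "bij_betw ((\<lambda>u. (u, 0::'e2)) \<circ> b1) {0..<?m} ((\<lambda>u. (u, 0)) ` Basis)"
      using b1 by (rule bij_betw_trans) (simp add: bij_betw_def inj_on_def)
    then show ?thesis
      by (rule bij_betw_cong [THEN iffD1, rotated]) (simp add: b_def)
  qed
  moreover have "bij_betw b {?m..<?m + ?n} ((\<lambda>u. (0, u)) ` Basis)"
  proof -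
    have "bij_betw (\<lambda>k. k - ?m) {?m..<?m + ?n} {0..<?n}"
      by (rule bij_betw_byWitness [where f' = "\<lambda>k. k + ?m"]) auto
    then have "bij_betw (b2 \<circ> (\<lambda>k. k - ?m)) {?m..<?m + ?n} Basis"
      using b2 by (rule bij_betw_trans)
    then have "bij_betw ((\<lambda>u. (0::'e1, u)) \<circ> (b2 \<circ> (\<lambda>k. k - ?m))) {?m..<?m + ?n} ((\<lambda>u. (0, u)) ` Basis)"
      by (rule bij_betw_trans) (simp add: bij_betw_def inj_on_def)
    then show ?thesis
      by (rule bij_betw_cong [THEN iffD1, rotated]) (simp add: b_def)
  qed
  ultimately have "bij_betw b ({0..<?m} \<union> {?m..<?m + ?n})
      ((\<lambda>u. (u, 0)) ` Basis \<union> (\<lambda>u. (0, u)) ` Basis)"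
    \<comment> \<open>No basis vector is zero, so the two embedded bases are disjoint.\<close>
    by (rule bij_betw_combine) (auto dest: nonzero_Basis)
  then have b: "bij_betw b {0..<?m + ?n} Basis"
    by (simp add: Basis_prod_def ivl_disj_un)
  have "Matrix.mat (?m + ?n) (?m + ?n) (\<lambda>(i, j). B (b i) (b j)) =
      four_block_mat (Matrix.mat ?m ?m (\<lambda>(i, j). B1 (b1 i) (b1 j))) (0\<^sub>m ?m ?n)
        (0\<^sub>m ?n ?m) (Matrix.mat ?n ?n (\<lambda>(i, j). B2 (b2 i) (b2 j)))"
    by (rule eq_matI) (auto simp: b_def b1B b2B 11 12 21 22)
  moreover have "Determinant.det (four_block_mat (Matrix.mat ?m ?m (\<lambda>(i, j). B1 (b1 i) (b1 j)))
      (0\<^sub>m ?m ?n) (0\<^sub>m ?n ?m) (Matrix.mat ?n ?n (\<lambda>(i, j). B2 (b2 i) (b2 j)))) =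
    Determinant.det (Matrix.mat ?m ?m (\<lambda>(i, j). B1 (b1 i) (b1 j))) *
    Determinant.det (Matrix.mat ?n ?n (\<lambda>(i, j). B2 (b2 i) (b2 j)))"
    by (rule det_four_block_mat_upper_right_zero) auto
  ultimately show ?thesis
    by (simp add: basis_det_eq_det_mat [OF b] basis_det_eq_det_mat [OF b1]
        basis_det_eq_det_mat [OF b2])
qed

text \<open>A vanishing determinant would give a nonzero kernel vector, and the quadratic form would
  vanish at the vector with these coordinates.\<close>

lemma basis_det_nonzero:
  fixes B :: "'e::euclidean_space \<Rightarrow> 'e \<Rightarrow> real"
  assumes pos: "\<And>w. w \<noteq> 0 \<Longrightarrow> 0 < (\<Sum>i\<in>Basis. \<Sum>j\<in>Basis. B i j * (w \<bullet> i) * (w \<bullet> j))"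
  shows "basis_det B \<noteq> 0"
proof
  assume 0: "basis_det B = 0"
  let ?n = "DIM('e)"
  obtain b :: "nat \<Rightarrow> 'e" where b: "bij_betw b {0..<?n} Basis"
    using ex_bij_betw_nat_finite finite_Basis by blast
  let ?M = "Matrix.mat ?n ?n (\<lambda>(i, j). B (b i) (b j))"
  have "Determinant.det ?M = 0"
    using 0 basis_det_eq_det_mat [OF b, of B] by simp
  then obtain v where v: "v \<in> carrier_vec ?n" "v \<noteq> 0\<^sub>v ?n" "?M *\<^sub>v v = 0\<^sub>v ?n"
    using det_0_iff_vec_prod_zero_field [of ?M ?n] by auto
  define w where "w = (\<Sum>k\<in>{0..<?n}. vec_index v k *\<^sub>R b k)"
  have bB: "b k \<in> Basis" if "k < ?n" for k using b that by (auto simp: bij_betw_def)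
  have bb: "b k \<bullet> b l = of_bool (k = l)" if "k < ?n" "l < ?n" for k l
    using that b by (auto simp: inner_Basis bB bij_betw_def inj_on_eq_iff)
  have w: "w \<bullet> b l = vec_index v l" if "l < ?n" for l
    using that by (simp add: w_def inner_sum_left bb sum.delta)
  have "w \<noteq> 0"
  proof
    assume "w = 0"
    then have "v = 0\<^sub>v ?n"
      using w v(1) by (intro eq_vecI) auto
    then show False using v(2) by simp
  qed
  have row: "(\<Sum>l\<in>{0..<?n}. B (b k) (b l) * vec_index v l) = 0" if "k < ?n" for k
    using arg_cong [OF v(3), of "\<lambda>u. vec_index u k"] that v(1)
    by (simp add: scalar_prod_def)
  have "(\<Sum>i\<in>Basis. \<Sum>j\<in>Basis. B i j * (w \<bullet> i) * (w \<bullet> j)) =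
      (\<Sum>k\<in>{0..<?n}. \<Sum>l\<in>{0..<?n}. B (b k) (b l) * (w \<bullet> b k) * (w \<bullet> b l))"
    by (simp add: sum.reindex_bij_betw [OF b, symmetric])
  \<comment> \<open>Grouping by rows exposes the entries of \<open>?M *\<^sub>v v\<close>, all of
    which are zero.\<close>
  also have "\<dots> = (\<Sum>k\<in>{0..<?n}. vec_index v k * (\<Sum>l\<in>{0..<?n}. B (b k) (b l) * vec_index v l))"
    by (simp add: w sum_distrib_left mult_ac)
  also have "\<dots> = 0" by (simp add: row)
  finally show False using pos [OF \<open>w \<noteq> 0\<close>] by simp
qed

text \<open>
  The segment from the identity to \<open>B\<close> consists of positive definite, hence nonsingular, forms, so
  the determinant does not change sign along it.
\<close>

lemma basis_det_pos:
  fixes B :: "'e::euclidean_space \<Rightarrow> 'e \<Rightarrow> real"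
  assumes pos: "\<And>w. w \<noteq> 0 \<Longrightarrow> 0 < (\<Sum>i\<in>Basis. \<Sum>j\<in>Basis. B i j * (w \<bullet> i) * (w \<bullet> j))"
  shows "0 < basis_det B"
proof (rule ccontr)
  assume neg: "\<not> 0 < basis_det B"
  define C where "C t i j = (1 - t) * of_bool (i = j) + t * B i j" for t i j
  have "continuous_on {0..1} (\<lambda>t. basis_det (C t))"
    unfolding C_def by (intro continuous_on_basis_det continuous_intros)
  moreover have "C 0 = (\<lambda>i j. of_bool (i = j))" "C 1 = B"
    by (simp_all add: C_def fun_eq_iff)
  ultimately obtain t where t: "0 \<le> t" "t \<le> 1" "basis_det (C t) = 0"
    using IVT2' [of "\<lambda>t. basis_det (C t)" 1 0 0] neg basis_det_one by fastforce
  have "basis_det (C t) \<noteq> 0"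
  proof (rule basis_det_nonzero)
    fix w :: 'e assume "w \<noteq> 0"
    let ?Q = "\<Sum>i\<in>Basis. \<Sum>j\<in>Basis. B i j * (w \<bullet> i) * (w \<bullet> j)"
    have "(\<Sum>i\<in>Basis. \<Sum>j\<in>Basis. C t i j * (w \<bullet> i) * (w \<bullet> j)) =
        (1 - t) * (\<Sum>i\<in>Basis. \<Sum>j\<in>Basis. of_bool (i = j) * (w \<bullet> i) * (w \<bullet> j)) + t * ?Q"
      unfolding C_def sum_distrib_left sum.distrib [symmetric]
      by (intro sum.cong refl) (simp add: algebra_simps)
    also have "(\<Sum>i\<in>Basis. \<Sum>j\<in>Basis. of_bool (i = j) * (w \<bullet> i) * (w \<bullet> j)) = w \<bullet> w"
      by (subst euclidean_inner) (simp add: of_bool_def if_distrib if_distribR cong: if_cong)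
    finally have eq: "(\<Sum>i\<in>Basis. \<Sum>j\<in>Basis. C t i j * (w \<bullet> i) * (w \<bullet> j)) =
        (1 - t) * (w \<bullet> w) + t * ?Q" .
    have "0 < w \<bullet> w" "0 < ?Q" using pos \<open>w \<noteq> 0\<close> by auto
    then show "0 < (\<Sum>i\<in>Basis. \<Sum>j\<in>Basis. C t i j * (w \<bullet> i) * (w \<bullet> j))"
      unfolding eq using t(1,2)
      \<comment> \<open>At \<open>t = 0\<close> only \<open>w \<bullet> w\<close> survives; for
        \<open>t > 0\<close> the term with \<open>?Q\<close> is positive and the other one is
        nonnegative.\<close>
      by (cases "t = 0") (auto intro!: add_nonneg_pos mult_nonneg_nonneg)
  qed
  then show False using t(3) by simp
qed

section \<open>The fundamental tensor\<close>

lemma dir_deriv_eqI: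
  "((\<lambda>t. h (y + t *\<^sub>R i)) has_field_derivative D) (at 0) \<Longrightarrow> dir_deriv h i y = D"
  by (simp add: dir_deriv_def DERIV_imp_deriv)

lemma has_field_derivative_dir_deriv:
  "(\<lambda>t. h (y + t *\<^sub>R i)) field_differentiable at 0 \<Longrightarrow>
    ((\<lambda>t. h (y + t *\<^sub>R i)) has_field_derivative dir_deriv h i y) (at 0)"
  by (simp add: dir_deriv_def DERIV_deriv_iff_field_differentiable)

text \<open>Allows a derivative at \<open>t = 0\<close> along a line to be computed from a formula
  valid only on an open set, which below is the complement of the origin.\<close>

lemma eventually_line_in_open:
  fixes y i :: "'a::real_normed_vector"
  assumes "open S" "y \<in> S"
  shows "\<forall>\<^sub>F t in nhds 0. y + t *\<^sub>R i \<in> S"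
proof -
  have "open ((\<lambda>t::real. y + t *\<^sub>R i) -` S)"
    using assms(1) by (intro continuous_open_vimage continuous_intros) auto
  then show ?thesis
    using eventually_nhds_in_open [of "(\<lambda>t::real. y + t *\<^sub>R i) -` S" 0] assms(2) by simp
qed

text \<open>The regularity of a squared Finsler metric on one tangent space; the origin is excluded
  because smoothness is required only away from it. It ensures that first and second values of
  \<open>dir_deriv\<close> are actual derivatives.\<close>

definition twice_dir_differentiable :: "('e::euclidean_space \<Rightarrow> real) \<Rightarrow> bool" where
  "twice_dir_differentiable h \<longleftrightarrow> (\<forall>y i j. y \<noteq> 0 \<longrightarrow>
     (\<lambda>t. h (y + t *\<^sub>R j)) field_differentiable at 0 \<and>
     (\<lambda>t. dir_deriv h j (y + t *\<^sub>R i)) field_differentiable at 0)"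

lemma has_field_derivative_slice:
  assumes "smooth_on S Q" "(x, y) \<in> S"
  shows "((\<lambda>t. Q (x, y + t *\<^sub>R i)) has_field_derivative
    frechet_derivative Q (at (x, y)) (0, i)) (at 0)"
proof -
  let ?D = "frechet_derivative Q (at (x, y))"
  have Q: "(Q has_derivative ?D) (at (x, y))"
    by (rule smooth_on_has_derivative [OF assms])
  have "((\<lambda>t. (x, y + t *\<^sub>R i)) has_derivative (\<lambda>t. (0, t *\<^sub>R i))) (at (0::real))"
    by (auto intro!: derivative_eq_intros)
  then have "(Q \<circ> (\<lambda>t. (x, y + t *\<^sub>R i)) has_derivative ?D \<circ> (\<lambda>t. (0, t *\<^sub>R i))) (at 0)"
    by (rule diff_chain_at) (simp add: Q)
  moreover have "?D (0, t *\<^sub>R i) = ?D (0, i) * t" for t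
    using linear_cmul [OF has_derivative_linear [OF Q], of t "(0, i)"] by simp
  ultimately show ?thesis
    by (simp add: has_field_derivative_def o_def)
qed

text \<open>Off the zero vector the first directional derivative is a Frechet derivative of
  \<open>Q\<close> in a fixed direction. This is again smooth on the same set, so the slice rule
  applies a second time.\<close>

lemma slice_second_derivative:
  fixes Q :: "'a::euclidean_space \<times> 'e::euclidean_space \<Rightarrow> real"
  assumes Q: "smooth_on (U \<times> (UNIV - {0})) Q" and x: "x \<in> U" and y: "y \<noteq> 0"
  shows "((\<lambda>t. dir_deriv (\<lambda>z. Q (x, z)) j (y + t *\<^sub>R i)) has_field_derivative
    frechet_derivative (\<lambda>p. frechet_derivative Q (at p) (0, j)) (at (x, y)) (0, i)) (at 0)"
proof -
  let ?D = "\<lambda>p. frechet_derivative Q (at p) (0, j)"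
  have D: "dir_deriv (\<lambda>z. Q (x, z)) j z = ?D (x, z)" if "z \<noteq> 0" for z
    by (rule dir_deriv_eqI) (rule has_field_derivative_slice [OF Q], use x that in simp)
  have "\<forall>\<^sub>F t in nhds 0. y + t *\<^sub>R i \<in> UNIV - {0}"
    using y by (intro eventually_line_in_open) auto
  then have ev: "\<forall>\<^sub>F t in nhds 0. dir_deriv (\<lambda>z. Q (x, z)) j (y + t *\<^sub>R i) = ?D (x, y + t *\<^sub>R i)"
    by eventually_elim (simp add: D)
  show ?thesis
    unfolding DERIV_cong_ev [OF refl ev refl]
    by (rule has_field_derivative_slice [OF smooth_on_frechet_derivative [OF Q]])
      (use x y in simp)
qed

lemma twice_dir_differentiable_slice:
  fixes Q :: "'a::euclidean_space \<times> 'e::euclidean_space \<Rightarrow> real"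
  assumes Q: "smooth_on (U \<times> (UNIV - {0})) Q" and x: "x \<in> U"
  shows "twice_dir_differentiable (\<lambda>z. Q (x, z))"
  unfolding twice_dir_differentiable_def
proof (intro allI impI conjI)
  fix y i j :: 'e assume y: "y \<noteq> 0"
  show "(\<lambda>t. Q (x, y + t *\<^sub>R j)) field_differentiable at 0"
    using has_field_derivative_slice [OF Q, of x y j] x y
    by (auto simp: field_differentiable_def)
  show "(\<lambda>t. dir_deriv (\<lambda>z. Q (x, z)) j (y + t *\<^sub>R i)) field_differentiable at 0"
    using slice_second_derivative [OF Q x y] by (auto simp: field_differentiable_def)
qed

text \<open>Joint continuity in point and vector later yields joint measurability of the volume
  integrand.\<close>

lemma continuous_on_dir_deriv2_slice:
  fixes Q :: "'a::euclidean_space \<times> 'e::euclidean_space \<Rightarrow> real"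
  assumes Q: "smooth_on (U \<times> (UNIV - {0})) Q"
  shows "continuous_on (U \<times> (UNIV - {0}))
    (\<lambda>(x, y). dir_deriv (dir_deriv (\<lambda>z. Q (x, z)) j) i y)"
proof -
  let ?D = "\<lambda>p. frechet_derivative (\<lambda>p. frechet_derivative Q (at p) (0, j)) (at p) (0, i)"
  have "dir_deriv (dir_deriv (\<lambda>z. Q (fst p, z)) j) i (snd p) = ?D p"
    if "p \<in> U \<times> (UNIV - {0})" for p
  proof -
    obtain x y where p: "p = (x, y)" "x \<in> U" "y \<noteq> 0" using \<open>p \<in> _\<close> by auto
    show ?thesis
      using dir_deriv_eqI [OF slice_second_derivative [OF Q p(2,3)]] by (simp add: p(1))
  qed
  moreover have "continuous_on (U \<times> (UNIV - {0})) ?D"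
    by (intro smooth_on_imp_continuous_on smooth_on_frechet_derivative Q)
  ultimately show ?thesis
    unfolding case_prod_unfold by (simp cong: continuous_on_cong)
qed

text \<open>Differentiate \<open>g (r *\<^sub>R (y + (t / r) *\<^sub>R i)) = c * g (y + (t / r)
  *\<^sub>R i)\<close> at \<open>t = 0\<close>; the inner function contributes \<open>1 / r\<close>.
  The free factor \<open>c\<close> lets the rule be applied with \<open>r\<^sup>2\<close> and then
  with \<open>r\<close>.\<close>

lemma dir_deriv_homogeneous:
  fixes g :: "'e::euclidean_space \<Rightarrow> real"
  assumes g: "\<And>z. z \<noteq> 0 \<Longrightarrow> g (r *\<^sub>R z) = c * g z"
    and y: "y \<noteq> 0" and r: "0 < r"
    and diff: "(\<lambda>t. g (y + t *\<^sub>R i)) field_differentiable at 0"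
  shows "dir_deriv g i (r *\<^sub>R y) = c / r * dir_deriv g i y"
proof (rule dir_deriv_eqI)
  have "\<forall>\<^sub>F t in nhds 0. y + t *\<^sub>R ((1 / r) *\<^sub>R i) \<in> UNIV - {0}"
    using y by (intro eventually_line_in_open) auto
  then have ev: "\<forall>\<^sub>F t in nhds 0. g (r *\<^sub>R y + t *\<^sub>R i) = c * g (y + (t / r) *\<^sub>R i)"
  proof eventually_elim
    case (elim t)
    have "r *\<^sub>R y + t *\<^sub>R i = r *\<^sub>R (y + (t / r) *\<^sub>R i)"
      using r by (simp add: scaleR_add_right)
    then show ?case using g elim by simp
  qed
  have "((\<lambda>t. g (y + (t / r) *\<^sub>R i)) has_field_derivative dir_deriv g i y * (1 / r)) (at 0)"
  proof (rule DERIV_chain2 [of "\<lambda>s. g (y + s *\<^sub>R i)"])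
    show "((\<lambda>s. g (y + s *\<^sub>R i)) has_field_derivative dir_deriv g i y) (at (0 / r))"
      using has_field_derivative_dir_deriv [OF diff] by simp
    show "((\<lambda>t. t / r) has_field_derivative 1 / r) (at 0)"
      using r by (auto intro!: derivative_eq_intros)
  qed
  from DERIV_cmult [OF this, of c]
  show "((\<lambda>t. g (r *\<^sub>R y + t *\<^sub>R i)) has_field_derivative c / r * dir_deriv g i y) (at 0)"
    unfolding DERIV_cong_ev [OF refl ev refl] by (simp add: mult_ac)
qed

text \<open>Each differentiation lowers the degree of homogeneity by one, from two to zero.\<close>

lemma dir_deriv2_homogeneous:
  fixes h :: "'e::euclidean_space \<Rightarrow> real"
  assumes h: "\<And>z. h (r *\<^sub>R z) = r\<^sup>2 * h z" and "twice_dir_differentiable h"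
    and y: "y \<noteq> 0" and r: "0 < r"
  shows "dir_deriv (dir_deriv h j) i (r *\<^sub>R y) = dir_deriv (dir_deriv h j) i y"
proof -
  have "dir_deriv h j (r *\<^sub>R z) = r * dir_deriv h j z" if "z \<noteq> 0" for z
    using dir_deriv_homogeneous [of h r "r\<^sup>2" z j] assms that
    by (simp add: twice_dir_differentiable_def power2_eq_square)
  then show ?thesis
    using dir_deriv_homogeneous [of "dir_deriv h j" r r y i] assms
    by (simp add: twice_dir_differentiable_def)
qed

text \<open>Both functions have the same derivatives in the relational sense, so
  \<open>deriv\<close> selects the same value for them, even where no derivative exists.\<close>

lemma deriv_add_const: "deriv (\<lambda>t. g t + k) x = deriv g (x::real)"
proof -
  have "((\<lambda>t. g t + k) has_field_derivative D) (at x) \<longleftrightarrow> (g has_field_derivative D) (at x)" for D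
  proof
    assume "((\<lambda>t. g t + k) has_field_derivative D) (at x)"
    then have "((\<lambda>t. g t + k - k) has_field_derivative D - 0) (at x)"
      by (intro DERIV_diff DERIV_const)
    then show "(g has_field_derivative D) (at x)" by simp
  qed (auto intro!: derivative_eq_intros)
  then show ?thesis by (simp add: deriv_def)
qed

section \<open>Second derivatives of a sum in separated variables\<close>

context
  fixes h1 :: "'e1::euclidean_space \<Rightarrow> real" and h2 :: "'e2::euclidean_space \<Rightarrow> real" and c :: real
    and H :: "'e1 \<times> 'e2 \<Rightarrow> real"
  defines "H \<equiv> \<lambda>z. h1 (fst z) + c * h2 (snd z)"
begin

text \<open>\<open>H\<close> has the shape of the squared warped metric on one tangent space, with
  \<open>c\<close> as the squared warping function. Along \<open>(j, 0)\<close> its second summand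
  is constant.\<close>

lemma dir_deriv_sum_fst: "dir_deriv H (j, 0) y = dir_deriv h1 j (fst y)"
  by (simp add: dir_deriv_def H_def deriv_add_const)

lemma dir_deriv_sum_snd:
  assumes "twice_dir_differentiable h2" "snd y \<noteq> 0"
  shows "dir_deriv H (0, j) y = c * dir_deriv h2 j (snd y)"
proof (rule dir_deriv_eqI)
  have "((\<lambda>t. h2 (snd y + t *\<^sub>R j)) has_field_derivative dir_deriv h2 j (snd y)) (at 0)"
    using assms by (intro has_field_derivative_dir_deriv) (simp add: twice_dir_differentiable_def)
  then show "((\<lambda>t. H (y + t *\<^sub>R (0, j))) has_field_derivative c * dir_deriv h2 j (snd y)) (at 0)"
    unfolding H_def by (auto intro!: derivative_eq_intros)
qed

lemma dir_deriv2_sum_fst_fst: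
  "dir_deriv (dir_deriv H (j, 0)) (i, 0) y = dir_deriv (dir_deriv h1 j) i (fst y)"
  by (simp add: dir_deriv_def [of "dir_deriv h1 j"] dir_deriv_def [of "dir_deriv H (j, 0)"]
      dir_deriv_sum_fst)

lemma dir_deriv2_sum_fst_snd: "dir_deriv (dir_deriv H (j, 0)) (0, i) y = 0"
  by (simp add: dir_deriv_def [of "dir_deriv H (j, 0)"] dir_deriv_sum_fst)

context
  assumes h2: "twice_dir_differentiable h2"
  fixes y :: "'e1 \<times> 'e2"
  assumes y: "snd y \<noteq> 0"
begin

text \<open>Moving along \<open>(i, 0)\<close> keeps \<open>snd y\<close> fixed and nonzero, so the
  first derivative is given by its formula on the whole line and is constant there.\<close>

lemma dir_deriv2_sum_snd_fst: "dir_deriv (dir_deriv H (0, j)) (i, 0) y = 0"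
  by (simp add: dir_deriv_def [of "dir_deriv H (0, j)"] dir_deriv_sum_snd [OF h2] y)

lemma dir_deriv2_sum_snd_snd:
  "dir_deriv (dir_deriv H (0, j)) (0, i) y = c * dir_deriv (dir_deriv h2 j) i (snd y)"
proof (rule dir_deriv_eqI)
  have "\<forall>\<^sub>F t in nhds 0. snd y + t *\<^sub>R i \<in> UNIV - {0}"
    using y by (intro eventually_line_in_open) auto
  then have ev: "\<forall>\<^sub>F t in nhds 0.
      dir_deriv H (0, j) (y + t *\<^sub>R (0, i)) = c * dir_deriv h2 j (snd y + t *\<^sub>R i)"
    by eventually_elim (simp add: dir_deriv_sum_snd [OF h2])
  have "((\<lambda>t. dir_deriv h2 j (snd y + t *\<^sub>R i)) has_field_derivative
      dir_deriv (dir_deriv h2 j) i (snd y)) (at 0)"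
    using h2 y by (intro has_field_derivative_dir_deriv) (simp add: twice_dir_differentiable_def)
  then show "((\<lambda>t. dir_deriv H (0, j) (y + t *\<^sub>R (0, i))) has_field_derivative
      c * dir_deriv (dir_deriv h2 j) i (snd y)) (at 0)"
    unfolding DERIV_cong_ev [OF refl ev refl] by (rule DERIV_cmult)
qed

end

end

section \<open>Fundamental tensors in one chart\<close>

context
  fixes A :: "('m::{second_countable_topology,t2_space}, 'e::euclidean_space) chart set"
    and F :: "'m tangent_function" and c :: "('m, 'e) chart"
  assumes fm: "finsler_manifold A F" and c: "c \<in> A"
begin

lemma smooth_on_local_expr_power2:
  "smooth_on (chart_image c \<times> (UNIV - {0})) (\<lambda>p. (local_expr A F c (fst p) (snd p))\<^sup>2)"
proof -
  have "open (chart_image c \<times> (UNIV - {0::'e}))"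
    using fm c by (intro open_Times open_chart_image) (auto simp: finsler_manifold_def)
  moreover have "smooth_on (chart_image c \<times> (UNIV - {0})) (\<lambda>p. local_expr A F c (fst p) (snd p))"
    using fm c by (simp add: finsler_manifold_def finsler_metric_def case_prod_unfold)
  ultimately show ?thesis
    unfolding power2_eq_square by (intro smooth_on_mult)
qed

lemma twice_dir_differentiable_local_expr_power2:
  "x \<in> chart_image c \<Longrightarrow> twice_dir_differentiable (\<lambda>z. (local_expr A F c x z)\<^sup>2)"
  using twice_dir_differentiable_slice [OF smooth_on_local_expr_power2] by simp

lemma fundamental_tensor_scaleR:
  assumes "x \<in> chart_image c" "y \<noteq> 0" "0 < r"
  shows "fundamental_tensor A F c x (r *\<^sub>R y) = fundamental_tensor A F c x y"
  using dir_deriv2_homogeneous [OF _ twice_dir_differentiable_local_expr_power2, of x r y] assms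
  by (simp add: fun_eq_iff fundamental_tensor_def local_expr_scaleR [OF fm c] power_mult_distrib)

lemma basis_det_fundamental_tensor_pos:
  "x \<in> chart_image c \<Longrightarrow> y \<noteq> 0 \<Longrightarrow> 0 < basis_det (fundamental_tensor A F c x y)"
  using fm c by (intro basis_det_pos) (simp add: finsler_manifold_def finsler_metric_def)

lemma continuous_on_basis_det_fundamental_tensor:
  "continuous_on (chart_image c \<times> (UNIV - {0}))
    (\<lambda>p. basis_det (fundamental_tensor A F c (fst p) (snd p)))"
  using continuous_on_dir_deriv2_slice [OF smooth_on_local_expr_power2]
  by (intro continuous_on_basis_det)
    (auto simp: fundamental_tensor_def case_prod_unfold intro!: continuous_intros)

lemma continuous_on_local_expr:
  "continuous_on (chart_image c \<times> UNIV) (\<lambda>p. local_expr A F c (fst p) (snd p))"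
  using fm c by (simp add: finsler_manifold_def finsler_metric_def case_prod_unfold)

end

lemma basis_det_fundamental_tensor_warped:
  assumes m1: "finsler_manifold A1 F1" and m2: "finsler_manifold A2 F2"
    and c: "c \<in> A1" and d: "d \<in> A2" and x: "x1 \<in> chart_image c" "x2 \<in> chart_image d"
    and y: "snd y \<noteq> (0::'e2::euclidean_space)"
  shows "basis_det (fundamental_tensor (product_atlas A1 A2) (warped_metric A1 A2 f F1 F2)
      (product_chart c d) (x1, x2) y) =
    basis_det (fundamental_tensor A1 F1 c x1 (fst y)) *
      ((f (chart_inv c x1))\<^sup>2 ^ DIM('e2) * basis_det (fundamental_tensor A2 F2 d x2 (snd y)))"
proof -
  let ?r = "f (chart_inv c x1)"
  have A: "smooth_atlas A1" "smooth_atlas A2"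
    using m1 m2 by (auto simp: finsler_manifold_def)
  have L: "(local_expr (product_atlas A1 A2) (warped_metric A1 A2 f F1 F2)
      (product_chart c d) (x1, x2) z)\<^sup>2 =
      (local_expr A1 F1 c x1 (fst z))\<^sup>2 + ?r\<^sup>2 * (local_expr A2 F2 d x2 (snd z))\<^sup>2" for z
    by (simp add: local_expr_warped_metric [OF A c d x])
  let ?h1 = "\<lambda>z. (local_expr A1 F1 c x1 z)\<^sup>2" and ?h2 = "\<lambda>z. (local_expr A2 F2 d x2 z)\<^sup>2"
  note h2 = twice_dir_differentiable_local_expr_power2 [OF m2 d x(2)]
  show ?thesis
    \<comment> \<open>Read backwards, the scaling rule absorbs the power of
      \<open>?r\<^sup>2\<close> into the second determinant, whose block is then
      \<open>?r\<^sup>2\<close> times the fundamental tensor of \<open>F2\<close>.\<close>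
    unfolding basis_det_scale [symmetric]
    by (rule basis_det_block_diagonal)
      (simp_all add: fundamental_tensor_def L
        dir_deriv2_sum_fst_fst [of ?h1 "?r\<^sup>2" ?h2] dir_deriv2_sum_fst_snd [of ?h1 "?r\<^sup>2" ?h2]
        dir_deriv2_sum_snd_fst [OF h2 y, of ?h1 "?r\<^sup>2"] dir_deriv2_sum_snd_snd [OF h2 y, of ?h1 "?r\<^sup>2"])
qed

section \<open>Densities and chart measures\<close>

text \<open>The integrand of the density, cut off outside the chart image and at
  \<open>y = 0\<close> so that it becomes a Borel function of both variables on the whole
  space.\<close>

definition HT_integrand ::
    "('m, 'e::euclidean_space) chart set \<Rightarrow> 'm tangent_function \<Rightarrow> ('m, 'e) chart \<Rightarrow>
     'e \<Rightarrow> 'e \<Rightarrow> ennreal" where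
  "HT_integrand A F c x y =
     (if x \<in> chart_image c \<and> y \<noteq> 0 \<and> local_expr A F c x y < 1
      then ennreal (basis_det (fundamental_tensor A F c x y)) else 0)"

lemma nn_integral_lborel_scaleR:
  fixes g :: "'e::euclidean_space \<Rightarrow> ennreal"
  assumes [measurable]: "g \<in> borel_measurable borel" and r: "0 < r"
  shows "(\<integral>\<^sup>+y. g y \<partial>lborel) = ennreal (r ^ DIM('e)) * (\<integral>\<^sup>+y. g (r *\<^sub>R y) \<partial>lborel)"
proof -
  have "(\<integral>\<^sup>+y. g y \<partial>lborel) =
      (\<integral>\<^sup>+y. g y \<partial>density (distr lborel borel (\<lambda>x. 0 + r *\<^sub>R x)) (\<lambda>_. ennreal (\<bar>r\<bar> ^ DIM('e))))"
    using r by (subst lborel_affine [of r 0]) auto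
  also have "\<dots> = ennreal (r ^ DIM('e)) * (\<integral>\<^sup>+y. g (r *\<^sub>R y) \<partial>lborel)"
    using r by (simp add: nn_integral_density nn_integral_distr nn_integral_cmult)
  finally show ?thesis .
qed

text \<open>
  No measurability is needed for these upper bounds: where the defining set function is not a measure,
  the left-hand side is 0. This is why the density of the warped product may be left unexamined.
\<close>

lemma emeasure_density_le:
  "emeasure (density M f) X \<le> (\<integral>\<^sup>+x. f x * indicator X x \<partial>M)"
  unfolding density_def emeasure_measure_of_conv by auto

lemma emeasure_distr_le: "emeasure (distr M N f) X \<le> emeasure M (f -` X \<inter> space M)"
  unfolding distr_def emeasure_measure_of_conv by auto

lemma emeasure_ball_neq_0: "emeasure lborel (ball (0::'e::euclidean_space) 1) \<noteq> 0"
  using less_imp_neq [OF unit_ball_vol_pos [of "real DIM('e)"]] by (simp add: emeasure_ball)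

lemma emeasure_ball_neq_top: "emeasure lborel (ball (0::'e::euclidean_space) 1) \<noteq> \<infinity>"
  using emeasure_lborel_ball_finite [of "0::'e" 1] by simp

section \<open>Measurability and integrals in one chart\<close>

context
  fixes A :: "('m::{second_countable_topology,t2_space}, 'e::euclidean_space) chart set"
    and F :: "'m tangent_function" and c :: "('m, 'e) chart"
  assumes fm: "finsler_manifold A F" and c: "c \<in> A"
begin

lemma HT_integrand_measurable:
  "(\<lambda>p. HT_integrand A F c (fst p) (snd p)) \<in> borel_measurable borel"
proof -
  let ?S = "chart_image c \<times> (UNIV - {0::'e})"
  let ?l = "\<lambda>p. indicator ?S p *\<^sub>R local_expr A F c (fst p) (snd p)"
  let ?d = "\<lambda>p. indicator ?S p *\<^sub>R basis_det (fundamental_tensor A F c (fst p) (snd p))"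
  have [measurable]: "?S \<in> sets borel"
    using fm c by (intro borel_open open_Times open_chart_image) (auto simp: finsler_manifold_def)
  have [measurable]: "?l \<in> borel_measurable borel"
    by (intro borel_measurable_continuous_on_indicator
        continuous_on_subset [OF continuous_on_local_expr [OF fm c]]) auto
  have [measurable]: "?d \<in> borel_measurable borel"
    by (intro borel_measurable_continuous_on_indicator
        continuous_on_basis_det_fundamental_tensor [OF fm c]) auto
  \<comment> \<open>On \<open>?S\<close> the extensions by 0 agree with the original functions, so
    the condition and the value can both be expressed by Borel functions.\<close>
  have "(\<lambda>p. HT_integrand A F c (fst p) (snd p)) =
      (\<lambda>p. if p \<in> ?S \<and> ?l p < 1 then ennreal (?d p) else 0)"
    by (auto simp: HT_integrand_def fun_eq_iff indicator_def)
  also have "\<dots> \<in> borel_measurable borel"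
    by measurable
  finally show ?thesis .
qed

lemma HT_integrand_measurable' [measurable]:
  assumes [measurable]: "g \<in> borel_measurable M" "h \<in> borel_measurable M"
  shows "(\<lambda>z. HT_integrand A F c (g z) (h z)) \<in> borel_measurable M"
proof -
  have "(\<lambda>z. (g z, h z)) \<in> measurable M borel" by measurable
  from measurable_compose [OF this HT_integrand_measurable] show ?thesis by simp
qed

lemma HT_density_eq:
  assumes "x \<in> chart_image c"
  shows "HT_density A F c x =
    (\<integral>\<^sup>+y. HT_integrand A F c x y \<partial>lborel) / emeasure lborel (ball (0::'e) 1)"
proof -
  have "AE y in lborel. y \<noteq> (0::'e)" by (rule AE_lborel_singleton)
  then have "(\<integral>\<^sup>+y\<in>{y. local_expr A F c x y < 1}.
        ennreal (basis_det (fundamental_tensor A F c x y)) \<partial>lborel) =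
      (\<integral>\<^sup>+y. HT_integrand A F c x y \<partial>lborel)"
    by (intro nn_integral_cong_AE, eventually_elim)
      (use assms in \<open>auto simp: HT_integrand_def indicator_def\<close>)
  then show ?thesis by (simp add: HT_density_def)
qed

text \<open>The ball volume is positive and finite, so division by it can be undone in
  \<open>ennreal\<close>.\<close>

lemma nn_integral_HT_integrand:
  assumes "x \<in> chart_image c"
  shows "(\<integral>\<^sup>+y. HT_integrand A F c x y \<partial>lborel) =
    HT_density A F c x * emeasure lborel (ball (0::'e) 1)"
proof -
  let ?v = "emeasure lborel (ball (0::'e) 1)"
  have "I / ?v * ?v = I" for I
    using mult_divide_eq_ennreal [of ?v I] emeasure_ball_neq_0 [where 'e = 'e]
      emeasure_ball_neq_top [where 'e = 'e]
    by (simp add: ennreal_divide_times ennreal_times_divide)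
  then show ?thesis
    by (simp add: HT_density_eq [OF assms])
qed

text \<open>On the chart image the density is, up to a constant factor, the integral of a jointly
  measurable function over one of its variables.\<close>

lemma HT_density_measurable:
  "(\<lambda>x. indicator (chart_image c) x * HT_density A F c x) \<in> borel_measurable borel"
proof -
  have [measurable]: "chart_image c \<in> sets borel"
    using fm c by (intro borel_open open_chart_image) (auto simp: finsler_manifold_def)
  have "(\<lambda>x. indicator (chart_image c) x * HT_density A F c x) =
      (\<lambda>x. indicator (chart_image c) x *
        ((\<integral>\<^sup>+y. HT_integrand A F c x y \<partial>lborel) / emeasure lborel (ball (0::'e) 1)))"
    by (auto simp: fun_eq_iff indicator_def HT_density_eq)
  also have "\<dots> \<in> borel_measurable borel"
    by measurable
  finally show ?thesis .
qed

text \<open>A constant value off the open chart image extends the continuous inverse chart to a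
  Borel function on the whole model space.\<close>

lemma chart_inv_measurable:
  "(\<lambda>x. if x \<in> chart_image c then chart_inv c x else undefined) \<in> borel_measurable borel"
proof -
  have "is_chart c" using fm c by (auto simp: finsler_manifold_def smooth_atlas_def)
  then have "continuous_on (chart_image c) (chart_inv c)" "open (chart_image c)"
    by (auto simp: is_chart_def homeomorphism_def)
  then show ?thesis
    by (subst measurable_restrict_space_iff [symmetric])
      (auto intro: borel_measurable_continuous_on_restrict)
qed

text \<open>Moves integrals from the manifold to \<open>lborel\<close> on the whole model space,
  where Tonelli's theorem can be applied to a product of two such spaces.\<close>

lemma nn_integral_HT_chart_measure:
  assumes [measurable]: "g \<in> borel_measurable borel"
  shows "(\<integral>\<^sup>+p. g p \<partial>HT_chart_measure A F c) =
    (\<integral>\<^sup>+x. indicator (chart_image c) x * HT_density A F c x *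
      g (if x \<in> chart_image c then chart_inv c x else undefined) \<partial>lborel)"
proof -
  have [measurable]: "chart_image c \<in> sets borel"
    using fm c by (intro borel_open open_chart_image) (auto simp: finsler_manifold_def)
  have dens: "HT_density A F c \<in> borel_measurable (restrict_space lborel (chart_image c))"
  proof (subst measurable_restrict_space_iff [where c = 0])
    have "(\<lambda>x. if x \<in> chart_image c then HT_density A F c x else 0) =
        (\<lambda>x. indicator (chart_image c) x * HT_density A F c x)"
      by (simp add: fun_eq_iff)
    then show "(\<lambda>x. if x \<in> chart_image c then HT_density A F c x else 0) \<in> borel_measurable lborel"
      using HT_density_measurable by simp
  qed auto
  have inv: "chart_inv c \<in> measurable (restrict_space lborel (chart_image c)) borel"
    using chart_inv_measurable by (subst measurable_restrict_space_iff) auto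
  have "(\<integral>\<^sup>+p. g p \<partial>HT_chart_measure A F c) =
      (\<integral>\<^sup>+x. HT_density A F c x * g (chart_inv c x) \<partial>restrict_space lborel (chart_image c))"
    unfolding HT_chart_measure_def using dens inv
    by (subst nn_integral_distr) (auto intro!: nn_integral_density)
  also have "\<dots> = (\<integral>\<^sup>+x. indicator (chart_image c) x * HT_density A F c x *
      g (if x \<in> chart_image c then chart_inv c x else undefined) \<partial>lborel)"
    by (subst nn_integral_restrict_space)
      (auto intro!: nn_integral_cong simp: indicator_def)
  finally show ?thesis .
qed

end

section \<open>Comparison of the warped product with the product measure\<close>

context
  fixes A1 :: "('m1::{second_countable_topology,t2_space}, 'e1::euclidean_space) chart set"
    and A2 :: "('m2::{second_countable_topology,t2_space}, 'e2::euclidean_space) chart set"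
    and F1 :: "'m1 tangent_function" and F2 :: "'m2 tangent_function"
    and f :: "'m1 \<Rightarrow> real" and b :: real
  assumes m1: "finsler_manifold A1 F1" and m2: "finsler_manifold A2 F2"
    and f: "\<And>p. 0 < f p" "\<And>p. f p \<le> b"
begin

lemma HT_density_warped_le:
  assumes c: "c \<in> A1" and d: "d \<in> A2" and x: "x1 \<in> chart_image c" "x2 \<in> chart_image d"
  shows "HT_density (product_atlas A1 A2) (warped_metric A1 A2 f F1 F2) (product_chart c d) (x1, x2)
    \<le> ennreal (b ^ DIM('e2)) *
        (emeasure lborel (ball (0::'e1) 1) * emeasure lborel (ball (0::'e2) 1) /
          emeasure lborel (ball (0::'e1 \<times> 'e2) 1)) *
        (HT_density A1 F1 c x1 * HT_density A2 F2 d x2)"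
proof -
  define r where "r = f (chart_inv c x1)"
  have r: "0 < r" "r \<le> b" using f by (auto simp: r_def)
  let ?A = "product_atlas A1 A2" and ?F = "warped_metric A1 A2 f F1 F2" and ?e = "product_chart c d"
  let ?G1 = "HT_integrand A1 F1 c x1" and ?G2 = "HT_integrand A2 F2 d x2"
  let ?n = "DIM('e2)"
  note [measurable] = HT_integrand_measurable' [OF m1 c] HT_integrand_measurable' [OF m2 d]
  have A: "smooth_atlas A1" "smooth_atlas A2"
    using m1 m2 by (auto simp: finsler_manifold_def)
  \<comment> \<open>A vector with a zero component lies in a coordinate hyperplane, which is a null
    set.\<close>
  have AE1: "AE y in lborel. fst y \<noteq> (0::'e1) \<and> snd y \<noteq> (0::'e2)"
  proof -
    obtain i :: 'e1 where i: "i \<in> Basis" using nonempty_Basis by blast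
    obtain j :: 'e2 where j: "j \<in> Basis" using nonempty_Basis by blast
    have "AE y in lborel. y \<bullet> (i, 0::'e2) \<noteq> 0" "AE y in lborel. y \<bullet> (0::'e1, j) \<noteq> 0"
      using i j by (auto intro!: AE_lborel_inner_neq simp: Basis_prod_def)
    then show ?thesis by eventually_elim (auto simp: inner_prod_def)
  qed
  have "(\<integral>\<^sup>+y\<in>{y. local_expr ?A ?F ?e (x1, x2) y < 1}.
        ennreal (basis_det (fundamental_tensor ?A ?F ?e (x1, x2) y)) \<partial>lborel) \<le>
      (\<integral>\<^sup>+y. ?G1 (fst y) * (ennreal (r\<^sup>2 ^ ?n) * ?G2 (r *\<^sub>R snd y)) \<partial>lborel)"
  proof (rule nn_integral_mono_AE, use AE1 in eventually_elim)
    fix y :: "'e1 \<times> 'e2" assume y: "fst y \<noteq> 0 \<and> snd y \<noteq> 0"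
    show "ennreal (basis_det (fundamental_tensor ?A ?F ?e (x1, x2) y)) *
        indicator {y. local_expr ?A ?F ?e (x1, x2) y < 1} y \<le>
      ?G1 (fst y) * (ennreal (r\<^sup>2 ^ ?n) * ?G2 (r *\<^sub>R snd y))"
    proof (cases "local_expr ?A ?F ?e (x1, x2) y < 1")
      case True
      let ?L1 = "local_expr A1 F1 c x1 (fst y)" and ?L2 = "local_expr A2 F2 d x2 (r *\<^sub>R snd y)"
      \<comment> \<open>Homogeneity moves the factor \<open>r\<close> inside \<open>F2\<close>,
        which is why \<open>?L2\<close> is taken at \<open>r *\<^sub>R snd y\<close>. Both squares
        being nonnegative, each of them is below 1.\<close>
      have "?L1\<^sup>2 + ?L2\<^sup>2 < 1"
        using True r by (simp add: local_expr_warped_metric [OF A c d x] r_def [symmetric]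
            local_expr_scaleR [OF m2 d x(2)] power_mult_distrib)
      then have "?L1\<^sup>2 < 1\<^sup>2" "?L2\<^sup>2 < 1\<^sup>2"
        using zero_le_power2 [of ?L1] zero_le_power2 [of ?L2] unfolding one_power2
        by linarith+
      then have "?L1 < 1" "?L2 < 1"
        using power2_less_imp_less by fastforce+
      then have "?G1 (fst y) = ennreal (basis_det (fundamental_tensor A1 F1 c x1 (fst y)))"
        "?G2 (r *\<^sub>R snd y) = ennreal (basis_det (fundamental_tensor A2 F2 d x2 (snd y)))"
        using x y r by (auto simp: HT_integrand_def fundamental_tensor_scaleR [OF m2 d x(2)])
      then show ?thesis
        using True y basis_det_fundamental_tensor_pos [OF m1 c x(1), of "fst y"]
          basis_det_fundamental_tensor_pos [OF m2 d x(2), of "snd y"]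
        by (simp add: basis_det_fundamental_tensor_warped [OF m1 m2 c d x] r_def [symmetric]
            ennreal_mult)
    qed simp
  qed
  also have "\<dots> = (\<integral>\<^sup>+y1. \<integral>\<^sup>+y2. ?G1 y1 * (ennreal (r\<^sup>2 ^ ?n) * ?G2 (r *\<^sub>R y2)) \<partial>lborel \<partial>lborel)"
    unfolding lborel_prod [symmetric] by (subst lborel.nn_integral_fst [symmetric]) auto
  also have "\<dots> = (\<integral>\<^sup>+y1. ?G1 y1 \<partial>lborel) *
      (ennreal (r\<^sup>2 ^ ?n) * (\<integral>\<^sup>+y2. ?G2 (r *\<^sub>R y2) \<partial>lborel))"
    by (simp add: nn_integral_cmult nn_integral_multc)
  \<comment> \<open>One of the two factors \<open>r ^ ?n\<close> is the Jacobian of the substitution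
    of \<open>r *\<^sub>R y2\<close>; the other is bounded by \<open>b ^ ?n\<close>.\<close>
  also have "ennreal (r\<^sup>2 ^ ?n) = ennreal (r ^ ?n) * ennreal (r ^ ?n)"
    using r by (simp add: ennreal_mult [symmetric] power2_eq_square power_mult_distrib)
  also have "\<dots> * (\<integral>\<^sup>+y2. ?G2 (r *\<^sub>R y2) \<partial>lborel) = ennreal (r ^ ?n) * (\<integral>\<^sup>+y2. ?G2 y2 \<partial>lborel)"
    using r by (subst nn_integral_lborel_scaleR [of ?G2 r]) (auto simp: mult.assoc)
  also have "(\<integral>\<^sup>+y1. ?G1 y1 \<partial>lborel) * (ennreal (r ^ ?n) * (\<integral>\<^sup>+y2. ?G2 y2 \<partial>lborel)) \<le>
      (\<integral>\<^sup>+y1. ?G1 y1 \<partial>lborel) * (ennreal (b ^ ?n) * (\<integral>\<^sup>+y2. ?G2 y2 \<partial>lborel))"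
    using r by (intro mult_left_mono mult_right_mono ennreal_leI power_mono) auto
  \<comment> \<open>Undoing the normalisations of the two factor densities brings in the volumes of
    their unit balls.\<close>
  also have "\<dots> = ennreal (b ^ ?n) *
      (emeasure lborel (ball (0::'e1) 1) * emeasure lborel (ball (0::'e2) 1)) *
      (HT_density A1 F1 c x1 * HT_density A2 F2 d x2)"
    unfolding nn_integral_HT_integrand [OF m1 c x(1)] nn_integral_HT_integrand [OF m2 d x(2)]
    by (simp only: mult_ac)
  finally have le: "(\<integral>\<^sup>+y\<in>{y. local_expr ?A ?F ?e (x1, x2) y < 1}.
        ennreal (basis_det (fundamental_tensor ?A ?F ?e (x1, x2) y)) \<partial>lborel) \<le> \<dots>" .
  show ?thesis
    unfolding HT_density_def [of ?A]
    by (rule order_trans [OF divide_right_mono_ennreal [OF le]])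
      (simp add: divide_ennreal_def mult_ac)
qed

text \<open>Integrating the density bound over the second coordinate first gives the chart measure
  of a section of \<open>B\<close>, which is at most its Holmes-Thompson measure; the first
  coordinate is then treated alike. Finiteness of the second measure makes the measures of sections
  measurable and their integral the product measure.\<close>

lemma HT_chart_measure_warped_le:
  assumes c: "c \<in> A1" and d: "d \<in> A2" and B: "B \<in> sets borel"
    and fin: "finite_measure (HT_measure A2 F2)"
  shows "emeasure (HT_chart_measure (product_atlas A1 A2) (warped_metric A1 A2 f F1 F2)
      (product_chart c d)) B
    \<le> ennreal (b ^ DIM('e2)) *
        (emeasure lborel (ball (0::'e1) 1) * emeasure lborel (ball (0::'e2) 1) /
          emeasure lborel (ball (0::'e1 \<times> 'e2) 1)) *
        emeasure (HT_measure A1 F1 \<Otimes>\<^sub>M HT_measure A2 F2) B"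
proof -
  let ?A = "product_atlas A1 A2" and ?F = "warped_metric A1 A2 f F1 F2" and ?e = "product_chart c d"
  define K where "K = ennreal (b ^ DIM('e2)) *
    (emeasure lborel (ball (0::'e1) 1) * emeasure lborel (ball (0::'e2) 1) /
      emeasure lborel (ball (0::'e1 \<times> 'e2) 1))"
  let ?U = "chart_image c" and ?V = "chart_image d"
  \<comment> \<open>Everything is extended to the whole model spaces. The densities vanish off the
    chart images, so the value \<open>undefined\<close> of the inverse charts has no effect.\<close>
  define s1 where "s1 x = indicator ?U x * HT_density A1 F1 c x" for x
  define s2 where "s2 x = indicator ?V x * HT_density A2 F2 d x" for x
  define v1 where "v1 x = (if x \<in> ?U then chart_inv c x else undefined)" for x
  define v2 where "v2 x = (if x \<in> ?V then chart_inv d x else undefined)" for x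
  have [measurable]: "s1 \<in> borel_measurable borel" "s2 \<in> borel_measurable borel"
    "v1 \<in> borel_measurable borel" "v2 \<in> borel_measurable borel"
    unfolding s1_def [abs_def] s2_def [abs_def] v1_def [abs_def] v2_def [abs_def]
    using HT_density_measurable [OF m1 c] HT_density_measurable [OF m2 d]
      chart_inv_measurable [OF m1 c] chart_inv_measurable [OF m2 d] by simp_all
  have A: "smooth_atlas A1" "smooth_atlas A2"
    using m1 m2 by (auto simp: finsler_manifold_def)
  have cd: "is_chart c" "is_chart d" using smooth_atlas_is_chart A c d by blast+
  have op: "open (?U \<times> ?V)"
    by (intro open_Times open_chart_image [OF A(1) c] open_chart_image [OF A(2) d])
  let ?\<mu>1 = "HT_measure A1 F1" and ?\<mu>2 = "HT_measure A2 F2"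
  have sets: "sets ?\<mu>1 = sets borel" "sets ?\<mu>2 = sets borel"
    unfolding HT_measure_def using c d by (auto intro!: sets_SUP)
  have B': "B \<in> sets (borel \<Otimes>\<^sub>M borel)" using B unfolding borel_prod .
  then have Bs: "B \<in> sets (?\<mu>1 \<Otimes>\<^sub>M ?\<mu>2)" "B \<in> sets (borel \<Otimes>\<^sub>M ?\<mu>2)"
    by (simp_all add: sets cong: sets_pair_measure_cong)
  interpret \<mu>2: finite_measure ?\<mu>2 by fact
  have [measurable]: "(\<lambda>p. emeasure ?\<mu>2 (Pair p -` B)) \<in> borel_measurable borel"
    by (rule \<mu>2.measurable_emeasure_Pair [OF Bs(2)])
  note [measurable] = B'
  have meas [measurable]: "(\<lambda>z. K * (s1 (fst z) * (s2 (snd z) * indicator B (v1 (fst z), v2 (snd z)))))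
      \<in> borel_measurable (lborel \<Otimes>\<^sub>M lborel)"
    by measurable
  have "emeasure (HT_chart_measure ?A ?F ?e) B \<le>
      (\<integral>\<^sup>+z. HT_density ?A ?F ?e z * indicator (chart_inv ?e -` B \<inter> chart_image ?e) z
        \<partial>restrict_space lborel (chart_image ?e))"
    unfolding HT_chart_measure_def
    by (rule order_trans [OF emeasure_distr_le order_trans [OF emeasure_density_le]])
      (simp add: space_restrict_space)
  also have "\<dots> = (\<integral>\<^sup>+z. HT_density ?A ?F ?e z * indicator (chart_inv ?e -` B \<inter> chart_image ?e) z *
      indicator (?U \<times> ?V) z \<partial>lborel)"
    using op by (subst nn_integral_restrict_space) (auto simp: chart_image_product_chart)
  also have "\<dots> \<le> (\<integral>\<^sup>+z. K * (s1 (fst z) * (s2 (snd z) * indicator B (v1 (fst z), v2 (snd z)))) \<partial>lborel)"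
  proof (rule nn_integral_mono)
    fix z :: "'e1 \<times> 'e2"
    show "HT_density ?A ?F ?e z * indicator (chart_inv ?e -` B \<inter> chart_image ?e) z * indicator (?U \<times> ?V) z
      \<le> K * (s1 (fst z) * (s2 (snd z) * indicator B (v1 (fst z), v2 (snd z))))"
    \<comment> \<open>Outside this set one of the two indicators on the left is zero.\<close>
    proof (cases "z \<in> ?U \<times> ?V \<and> chart_inv ?e z \<in> B")
      case True
      then obtain x1 x2 where z: "z = (x1, x2)" "x1 \<in> ?U" "x2 \<in> ?V" by auto
      then show ?thesis
        using True HT_density_warped_le [OF c d z(2,3)]
        by (simp add: chart_inv_product_chart [OF cd] chart_image_product_chart
            s1_def s2_def v1_def v2_def K_def mult.assoc)
    qed auto
  qed
  also have "\<dots> = (\<integral>\<^sup>+x1. \<integral>\<^sup>+x2. K * (s1 x1 * (s2 x2 * indicator B (v1 x1, v2 x2))) \<partial>lborel \<partial>lborel)"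
    unfolding lborel_prod [symmetric] by (subst lborel.nn_integral_fst [OF meas, symmetric]) simp
  also have "\<dots> = K * (\<integral>\<^sup>+x1. s1 x1 * (\<integral>\<^sup>+x2. s2 x2 * indicator B (v1 x1, v2 x2) \<partial>lborel) \<partial>lborel)"
    by (simp add: nn_integral_cmult)
  also have "\<dots> \<le> K * (\<integral>\<^sup>+x1. s1 x1 * emeasure ?\<mu>2 (Pair (v1 x1) -` B) \<partial>lborel)"
  proof (intro mult_left_mono nn_integral_mono)
    fix x1
    have Bp: "Pair (v1 x1) -` B \<in> sets borel" using sets_Pair1 [OF B'] .
    have "(\<integral>\<^sup>+x2. s2 x2 * indicator B (v1 x1, v2 x2) \<partial>lborel) =
        (\<integral>\<^sup>+q. indicator (Pair (v1 x1) -` B) q \<partial>HT_chart_measure A2 F2 d)"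
      by (subst nn_integral_HT_chart_measure [OF m2 d])
        (auto intro!: nn_integral_cong borel_measurable_indicator Bp simp: s2_def v2_def indicator_def)
    also have "\<dots> = emeasure (HT_chart_measure A2 F2 d) (Pair (v1 x1) -` B)"
      using Bp by simp
    also have "\<dots> \<le> emeasure ?\<mu>2 (Pair (v1 x1) -` B)"
      using d by (intro le_measureD3) (auto simp: sets, auto simp: HT_measure_def intro: SUP_upper)
    finally show "(\<integral>\<^sup>+x2. s2 x2 * indicator B (v1 x1, v2 x2) \<partial>lborel) \<le> \<dots>" .
  qed auto
  also have "(\<integral>\<^sup>+x1. s1 x1 * emeasure ?\<mu>2 (Pair (v1 x1) -` B) \<partial>lborel) =
      (\<integral>\<^sup>+p. emeasure ?\<mu>2 (Pair p -` B) \<partial>HT_chart_measure A1 F1 c)"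
    by (subst nn_integral_HT_chart_measure [OF m1 c])
      (auto intro!: nn_integral_cong simp: s1_def v1_def)
  also have "K * \<dots> \<le> K * (\<integral>\<^sup>+p. emeasure ?\<mu>2 (Pair p -` B) \<partial>?\<mu>1)"
    using c by (intro mult_left_mono nn_integral_mono_measure)
      (auto simp: sets, auto simp: HT_measure_def intro: SUP_upper)
  also have "\<dots> = K * emeasure (?\<mu>1 \<Otimes>\<^sub>M ?\<mu>2) B"
    by (simp add: \<mu>2.emeasure_pair_measure_alt [OF Bs(1)])
  finally show ?thesis unfolding K_def .
qed

end

section \<open>Finiteness of the total volume\<close>

theorem theorem5:
  fixes A1 :: "('m1::{second_countable_topology,t2_space}, 'e1::euclidean_space) chart set"
    and A2 :: "('m2::{second_countable_topology,t2_space}, 'e2::euclidean_space) chart set"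
    and F1 :: "'m1 tangent_function"
    and F2 :: "'m2 tangent_function"
    and f :: "'m1 \<Rightarrow> real"
    and a b :: real
  assumes "finsler_manifold A1 F1"
    and "finsler_manifold A2 F2"
    and "HT_volume A1 F1 < \<infinity>"
    and "HT_volume A2 F2 < \<infinity>"
    and "f \<in> smooth_functions A1"
    and "\<And>p. 0 < f p"
    and "0 < a" and "a \<le> b"
    and "\<And>p. a \<le> f p \<and> f p \<le> b"
  shows "HT_volume (product_atlas A1 A2) (warped_metric A1 A2 f F1 F2) < \<infinity>"
proof -
  let ?A = "product_atlas A1 A2" and ?F = "warped_metric A1 A2 f F1 F2"
  let ?\<mu>1 = "HT_measure A1 F1" and ?\<mu>2 = "HT_measure A2 F2"
  let ?v1 = "emeasure lborel (ball (0::'e1) 1)" and ?v2 = "emeasure lborel (ball (0::'e2) 1)"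
    and ?v = "emeasure lborel (ball (0::'e1 \<times> 'e2) 1)"
  define K where "K = ennreal (b ^ DIM('e2)) * (?v1 * ?v2 / ?v)"
  have ne: "A1 \<noteq> {}" "A2 \<noteq> {}"
    using assms(1,2) by (auto simp: finsler_manifold_def smooth_atlas_def)
  then have sets: "sets ?\<mu>1 = sets borel" "sets ?\<mu>2 = sets borel"
    unfolding HT_measure_def by (auto intro!: sets_SUP)
  then have space: "space ?\<mu>1 = UNIV" "space ?\<mu>2 = UNIV"
    by (auto dest: sets_eq_imp_space_eq)
  interpret \<mu>2: finite_measure ?\<mu>2
    using assms(4) by (intro finite_measureI) (simp add: HT_volume_def space)
  \<comment> \<open>A setwise comparison of measures requires equal sigma-algebras; by second
    countability the product sigma-algebra is the Borel one.\<close>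
  have setsP: "sets (scale_measure K (?\<mu>1 \<Otimes>\<^sub>M ?\<mu>2)) = sets borel"
    using sets by (simp add: borel_prod [symmetric] cong: sets_pair_measure_cong)
  have "HT_measure ?A ?F \<le> scale_measure K (?\<mu>1 \<Otimes>\<^sub>M ?\<mu>2)"
    unfolding HT_measure_def [of ?A]
  proof (rule SUP_least)
    fix e assume "e \<in> ?A"
    then obtain c d where e: "e = product_chart c d" and cd: "c \<in> A1" "d \<in> A2"
      unfolding product_atlas_def by blast
    have "emeasure (HT_chart_measure ?A ?F e) B \<le> emeasure (scale_measure K (?\<mu>1 \<Otimes>\<^sub>M ?\<mu>2)) B"
      if "B \<in> sets borel" for B
      unfolding e emeasure_scale_measure K_def
      by (rule HT_chart_measure_warped_le [OF assms(1,2) _ _ cd that \<mu>2.finite_measure_axioms])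
        (use assms(6,9) in auto)
    then show "HT_chart_measure ?A ?F e \<le> scale_measure K (?\<mu>1 \<Otimes>\<^sub>M ?\<mu>2)"
      using setsP by (subst le_measure) auto
  qed
  moreover have "?A \<noteq> {}" using ne unfolding product_atlas_def by blast
  then have "sets (HT_measure ?A ?F) = sets borel"
    unfolding HT_measure_def by (intro sets_SUP) auto
  ultimately have "HT_volume ?A ?F \<le> K * emeasure (?\<mu>1 \<Otimes>\<^sub>M ?\<mu>2) UNIV"
    unfolding HT_volume_def using le_measureD3 setsP by fastforce
  also have "\<dots> = K * (HT_volume A1 F1 * HT_volume A2 F2)"
    using \<mu>2.emeasure_pair_measure_Times [of UNIV ?\<mu>1 UNIV]
    by (simp add: HT_volume_def sets)
  also have "\<dots> < \<infinity>"
  proof -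
    \<comment> \<open>The numerator is a product of finite volumes and the denominator is
      nonzero.\<close>
    have "?v1 * ?v2 / ?v \<noteq> \<infinity>"
      using emeasure_ball_neq_0 [where 'e = "'e1 \<times> 'e2"]
        emeasure_ball_neq_top [where 'e = 'e1] emeasure_ball_neq_top [where 'e = 'e2]
      by (simp add: ennreal_divide_eq_top_iff ennreal_mult_eq_top_iff)
    then show ?thesis
      using assms(3,4) by (simp add: K_def ennreal_mult_less_top less_top)
  qed
  finally show ?thesis .
qed

end
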